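(* Let $A$, $B$ and $B'$ be matrices in $\mathbb{C}^{d\times d}$. Then the matrix function $\Gamma_1(A,B,B';x,y)$ satisfies the following infinite summation formulae for $|t|<1$: (1) $(1-t)^{-A}\,\Gamma_1\!\left(A,B,B';\frac{x}{1-t},y\right)=\sum_{n=0}^{\infty}\frac{(A)_n}{n!}\,\Gamma_1(A+nI,B,B';x,y)\,t^n$; (2) if $BB'=B'B$, $\Gamma_1\!\left(A,B,B';x(1-t),\frac{y}{1-t}\right)(1-t)^{-B}=\sum_{n=0}^{\infty}\Gamma_1(A,B+nI,B';x,y)\,\frac{(B)_n}{n!}\,t^n$; (3) $\Gamma_1\!\left(A,B,B';\frac{x}{1-t},y(1-t)\right)(1-t)^{-B'}=\sum_{n=0}^{\infty}\Gamma_1(A,B,B'+nI;x,y)\,\frac{(B')_n}{n!}\,t^n$.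
   Context: $\Gamma_1(A,B,B';x,y)=\sum_{m,n\ge0}(A)_m(B)_{n-m}(B')_{m-n}\frac{x^m y^n}{m!\,n!}$ (a confluent Horn matrix function, not the gamma function). Matrix Pochhammer symbol: for $M\in\mathbb{C}^{d\times d}$, $(M)_0=I$, $(M)_n=M(M+I)\cdots(M+(n-1)I)$ for $n\ge1$, and $(M)_{-n}=(-1)^n(I-M)_n^{-1}$. For $|t|<1$, $(1-t)^{-M}=\sum_{n\ge0}\frac{(M)_n}{n!}t^n$.
   Formalization: Proved where the Pochhammer inverses exist, |x|<1 and Γ₁'s new first argument has modulus <1: equality holds whenever the right-hand series converges (it can diverge for some |t|<1); convergence is shown for |x|+|t|<1 in (1),(3) and |x|(1+|t|)<1 in (2). *)

theory Defs
  imports "HOL-Analysis.Analysis"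
begin

text \<open>Matrices in \<open>\<complex>\<^bsup>d\<times>d\<^esup>\<close> have type \<open>complex^'d^'d\<close>. On this type \<open>*\<close>, \<open>^\<close>
  and \<open>1\<close> are the componentwise operations, so everything below uses \<open>**\<close> and \<open>mat\<close>;
  \<open>mat c\<close> is \<open>c I\<close>, and \<open>mat c ** M\<close> is the scalar multiple \<open>c M\<close>.\<close>

primrec mpoch_nat :: "complex^'d^'d \<Rightarrow> nat \<Rightarrow> complex^'d^'d" where
  "mpoch_nat M 0 = mat 1"
| "mpoch_nat M (Suc n) = mpoch_nat M n ** (M + mat (of_nat n))"

definition mpoch :: "complex^'d^'d \<Rightarrow> int \<Rightarrow> complex^'d^'d" where
  "mpoch M k =
     (if k \<ge> 0 then mpoch_nat M (nat k)
      else mat ((- 1) ^ nat (- k)) ** matrix_inv (mpoch_nat (mat 1 - M) (nat (- k))))"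

text \<open>The symbols with negative index exist only if the matrices to be inverted are invertible
  (\<open>matrix_inv\<close> is unspecified otherwise).\<close>

definition mpoch_defined :: "complex^'d^'d \<Rightarrow> bool" where
  "mpoch_defined M \<longleftrightarrow> (\<forall>n. invertible (mpoch_nat (mat 1 - M) n))"

text \<open>The double series of \<open>\<Gamma>\<^sub>1\<close>. For \<open>mpoch_defined B\<close> and \<open>mpoch_defined B'\<close> its terms are defined,
  and it converges absolutely for \<open>norm x < 1\<close> and every \<open>y\<close>.\<close>

definition Horn_Gamma1 ::
  "complex^'d^'d \<Rightarrow> complex^'d^'d \<Rightarrow> complex^'d^'d \<Rightarrow> complex \<Rightarrow> complex \<Rightarrow> complex^'d^'d" where
  "Horn_Gamma1 A B B' x y =
     (\<Sum>\<^sub>\<infinity>(m, n) \<in> UNIV. mat (x ^ m * y ^ n / (fact m * fact n)) **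
        (mpoch A (int m) ** mpoch B (int n - int m) ** mpoch B' (int m - int n)))"

text \<open>\<open>(1 - t)\<^bsup>-M\<^esup>\<close>, for \<open>norm t < 1\<close>.\<close>

definition one_minus_mpowr :: "complex \<Rightarrow> complex^'d^'d \<Rightarrow> complex^'d^'d" where
  "one_minus_mpowr t M = (\<Sum>n. mat (t ^ n / fact n) ** mpoch M (int n))"

end

theory Submission
  imports Defs "HOL-Complex_Analysis.Conformal_Mappings"
begin

text \<open>Write \<open>F(t)\<close> for a left-hand side. Its double series has the terms
\<open>u(t)\<^sup>m v(t)\<^sup>n / (m! n!)\<close> times \<open>(A)\<^sub>m (B)\<^sub>n\<^sub>-\<^sub>m (B')\<^sub>m\<^sub>-\<^sub>n\<close>, multiplied by \<open>(1 - t)\<close> to a matrix power.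
The scalars \<open>u(t)\<^sup>m v(t)\<^sup>n\<close> contribute an integer power of \<open>1 - t\<close>, which shifts the matrix exponent to
\<open>A + m\<close>, \<open>B + (n - m)\<close> or \<open>B' + (m - n)\<close>. The binomial series of that power then has the
coefficients \<open>(M + N)\<^sub>k / k!\<close>, and the identity \<open>(M)\<^sub>N (M + N)\<^sub>k = (M)\<^sub>N\<^sub>+\<^sub>k = (M)\<^sub>k (M + k)\<^sub>N\<close>, valid for every
integer \<open>N\<close>, turns the \<open>k\<close>-th coefficient into the \<open>(m, n)\<close>-th term of \<open>\<Gamma>\<^sub>1\<close> with the parameter raised by \<open>k\<close>.
In the second formula the power of \<open>1 - t\<close> has to move past \<open>(B')\<^sub>m\<^sub>-\<^sub>n\<close>, hence \<open>BB' = B'B\<close>.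

The interchange of the sums over \<open>k\<close> and \<open>(m, n)\<close> needs no estimate of the triple series. The double
series converges locally uniformly in \<open>t\<close> on the open set \<open>\<Omega>\<close> of those \<open>t\<close> in the unit disc for which its
first argument stays in the unit disc; so \<open>F\<close> is holomorphic on \<open>\<Omega>\<close>, and by Weierstrass its
Taylor coefficients at \<open>0\<close> are the sums of those of the terms (\<open>horn_taylor_coefficients\<close>). The right-hand side is
therefore the Taylor series of \<open>F\<close> at \<open>0\<close>. The majorant is \<open>horn_majorant_summable\<close>: both
\<open>(A)\<^sub>m / m!\<close> and \<open>(B)\<^sub>N (B')\<^sub>-\<^sub>N\<close> grow more slowly than every geometric sequence of ratio above \<open>1\<close>.

On a disc around \<open>0\<close> contained in \<open>\<Omega>\<close>, the Taylor series converges, which gives the summability claims. At other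
points of \<open>\<Omega>\<close> summability is a hypothesis, and the sum has to be identified: the power series is holomorphic on
the open disc up to \<open>t\<close>, agrees with \<open>F\<close> on the part of that disc inside \<open>\<Omega>\<close> because this part is connected, and
Abel's limit theorem passes to the boundary point \<open>t\<close> (\<open>taylor_series_eq\<close>). The
connectedness is clear for the second formula, where \<open>\<Omega>\<close> is convex; in the other two a disc around \<open>1\<close>
is cut out of a disc around \<open>0\<close>, see \<open>connected_disc_minus_disc\<close>.\<close>

section \<open>Scalar matrices, commuting matrices and inverses\<close>

lemma mat_mult_component [simp]: "(mat c ** M) $ i $ j = (c::complex) * M $ i $ j"
  by (simp add: matrix_matrix_mult_def mat_def if_distrib if_distribR cong: if_cong)

lemma mult_mat_component [simp]: "(M ** mat c) $ i $ j = (c::complex) * M $ i $ j"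
  by (simp add: matrix_matrix_mult_def mat_def if_distrib if_distribR mult.commute cong: if_cong)

lemma mat_component: "mat c $ i $ j = (if i = j then c else 0)"
  by (simp add: mat_def)

lemma mat_0_eq [simp]: "mat 0 = (0 :: complex^'d^'d)"
  by (simp add: vec_eq_iff mat_component)

lemma mult_mat: "M ** mat c = mat (c::complex) ** M"
  by (simp add: vec_eq_iff)

lemma mat_mult_left_commute: "M ** (mat c ** N) = mat (c::complex) ** (M ** N)"
  by (simp add: matrix_mul_assoc mult_mat)

lemma mat_add: "mat (a::complex) + mat b = (mat (a + b) :: complex^'d^'d)"
  by (simp add: vec_eq_iff mat_component)

lemma mat_mult_mat: "mat (a::complex) ** mat b = (mat (a * b) :: complex^'d^'d)"
  by (simp add: vec_eq_iff mat_component)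

lemma matrix_add_rdistrib: "(B + C) ** A = B ** A + C ** (A::complex^'d^'d)"
  by (simp add: vec_eq_iff matrix_matrix_mult_def distrib_right sum.distrib)

lemma matrix_diff_ldistrib: "A ** (B - C) = A ** B - A ** (C::complex^'d^'d)"
  by (simp add: vec_eq_iff matrix_matrix_mult_def right_diff_distrib sum_subtractf)

lemma matrix_diff_rdistrib: "(B - C) ** A = B ** A - C ** (A::complex^'d^'d)"
  by (simp add: vec_eq_iff matrix_matrix_mult_def left_diff_distrib sum_subtractf)

lemma commutes_add_mat:
  fixes X M :: "complex^'d^'d"
  assumes "X ** M = M ** X"
  shows "X ** (M + mat c) = (M + mat c) ** X"
  using assms by (simp add: matrix_add_ldistrib matrix_add_rdistrib mult_mat)

lemma commutes_mat_diff:
  fixes X M :: "complex^'d^'d"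
  assumes "X ** M = M ** X"
  shows "X ** (mat c - M) = (mat c - M) ** X"
  using assms by (simp add: matrix_diff_ldistrib matrix_diff_rdistrib mult_mat)

lemma commutes_mult:
  fixes X M N :: "complex^'d^'d"
  assumes "X ** M = M ** X" "X ** N = N ** X"
  shows "X ** (M ** N) = (M ** N) ** X"
  by (metis assms matrix_mul_assoc)

lemma matrix_inv_inverse:
  fixes M :: "complex^'d^'d"
  assumes "invertible M"
  shows "M ** matrix_inv M = mat 1" "matrix_inv M ** M = mat 1"
proof -
  have "M ** matrix_inv M = mat 1 \<and> matrix_inv M ** M = mat 1"
    unfolding matrix_inv_def using assms[unfolded invertible_def] by (rule someI_ex)
  then show "M ** matrix_inv M = mat 1" "matrix_inv M ** M = mat 1" by auto
qed

lemma commutes_matrix_inv: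
  fixes X M :: "complex^'d^'d"
  assumes "X ** M = M ** X" "invertible M"
  shows "X ** matrix_inv M = matrix_inv M ** X"
proof -
  have "matrix_inv M ** X = matrix_inv M ** (X ** M) ** matrix_inv M"
    using matrix_inv_inverse(1)[OF assms(2)] by (simp flip: matrix_mul_assoc)
  also have "\<dots> = X ** matrix_inv M"
    using matrix_inv_inverse(2)[OF assms(2)] by (simp add: assms(1) matrix_mul_assoc)
  finally show ?thesis ..
qed

section \<open>Matrix Pochhammer symbols with integer index\<close>

lemma commutes_mpoch_nat:
  fixes X M :: "complex^'d^'d"
  assumes "X ** M = M ** X"
  shows "X ** mpoch_nat M n = mpoch_nat M n ** X"
  by (induction n) (simp_all add: commutes_mult commutes_add_mat assms)

lemma commutes_mpoch:
  fixes X M :: "complex^'d^'d"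
  assumes "X ** M = M ** X" "mpoch_defined M"
  shows "X ** mpoch M N = mpoch M N ** X"
  using assms
  by (auto simp: mpoch_def mpoch_defined_def mult_mat
      intro!: commutes_mpoch_nat commutes_mult commutes_matrix_inv commutes_mat_diff)

lemma mpoch_of_nat [simp]: "mpoch M (int n) = mpoch_nat M n"
  by (simp add: mpoch_def)

lemma mpoch_0 [simp]: "mpoch M 0 = mat 1"
  by (simp add: mpoch_def)

text \<open>At \<open>n = 0\<close> the definition takes its other branch, and the formula still holds since the inverse of the identity
is the identity.\<close>

lemma mpoch_neg:
  fixes M :: "complex^'d^'d"
  shows "mpoch M (- int n) = mat ((- 1) ^ n) ** matrix_inv (mpoch_nat (mat 1 - M) n)"
proof (cases "n = 0")
  case True
  have "invertible (mat 1 :: complex^'d^'d)" unfolding invertible_def by auto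
  from matrix_inv_inverse(1)[OF this] have "matrix_inv (mat 1 :: complex^'d^'d) = mat 1" by simp
  then show ?thesis using True by (simp add: mpoch_def)
qed (simp add: mpoch_def)

text \<open>Up to sign, \<open>M - (n + 1)I\<close> is the last factor of \<open>(I - M)\<^sub>n\<^sub>+\<^sub>1\<close>, and a factor of an invertible square
matrix is invertible.\<close>

lemma invertible_mpoch_factor:
  fixes M :: "complex^'d^'d"
  assumes "mpoch_defined M"
  shows "invertible (M - mat (of_nat (Suc n)))"
proof -
  define Q where "Q = mpoch_nat (mat 1 - M) n"
  define F where "F = mat 1 - M + mat (of_nat n)"
  have F: "F = mat (-1) ** (M - mat (of_nat (Suc n)))"
    by (auto simp: F_def vec_eq_iff mat_component algebra_simps)
  have "invertible (Q ** F)"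
    using assms unfolding mpoch_defined_def Q_def F_def by (metis mpoch_nat.simps(2))
  then obtain Y where "Y ** (Q ** F) = mat 1" unfolding invertible_def by blast
  then have "(Y ** Q ** mat (-1)) ** (M - mat (of_nat (Suc n))) = mat 1"
    by (simp add: F matrix_mul_assoc)
  then show ?thesis using invertible_left_inverse by blast
qed

text \<open>The recursion that defines the symbol for nonnegative indices extends to all integers: for
negative \<open>N\<close> the factor \<open>M + N I\<close> cancels against the outermost inverse factor.\<close>

lemma mpoch_Suc_index:
  fixes M :: "complex^'d^'d"
  assumes "mpoch_defined M"
  shows "mpoch M (N + 1) = mpoch M N ** (M + mat (of_int N))"
proof (cases "N \<ge> 0")
  case True
  then obtain n where "N = int n" using nonneg_int_cases by blast
  then show ?thesis by (metis mpoch_of_nat mpoch_nat.simps(2) of_int_of_nat_eq of_nat_Suc add.commute)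
next
  case False
  then obtain n where N: "N = - int (Suc n)" by (metis not_le int_cases of_nat_0_le_iff)
  define Q where "Q = mpoch_nat (mat 1 - M) n"
  define R where "R = mpoch_nat (mat 1 - M) (Suc n)"
  define F where "F = mat 1 - M + mat (of_nat n)"
  have inv: "invertible Q" "invertible R"
    using assms unfolding mpoch_defined_def Q_def R_def by blast+
  have "F ** (mat 1 - M) = (mat 1 - M) ** F" unfolding F_def
    by (simp add: commutes_add_mat)
  then have R: "R = F ** Q"
    using commutes_mpoch_nat[of F "mat 1 - M" n] by (simp add: R_def F_def Q_def)
  have "matrix_inv R ** F = matrix_inv R ** F ** Q ** matrix_inv Q"
    using matrix_inv_inverse(1)[OF inv(1)] by (simp flip: matrix_mul_assoc)
  also have "\<dots> = matrix_inv Q"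
    using matrix_inv_inverse(2)[OF inv(2)] by (simp add: R matrix_mul_assoc)
  finally have inv_eq: "matrix_inv R ** F = matrix_inv Q" .
  have F: "M + mat (of_int N) = mat (-1) ** F"
    by (auto simp: F_def N vec_eq_iff mat_component algebra_simps)
  have MN: "mpoch M N = mat ((-1) ^ Suc n) ** matrix_inv R"
    unfolding N R_def by (rule mpoch_neg)
  have "mpoch M N ** (M + mat (of_int N))
      = mat ((-1) ^ Suc n) ** (matrix_inv R ** (mat (-1) ** F))"
    unfolding F MN by (rule matrix_mul_assoc[symmetric])
  also have "\<dots> = mat ((-1) ^ Suc n) ** mat (-1) ** (matrix_inv R ** F)"
    by (metis mat_mult_left_commute matrix_mul_assoc)
  also have "\<dots> = mat ((-1) ^ n) ** (matrix_inv R ** F)"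
    by (simp add: mat_mult_mat)
  finally have "mpoch M N ** (M + mat (of_int N)) = mat ((-1) ^ n) ** (matrix_inv R ** F)" .
  moreover have "mpoch M (N + 1) = mat ((-1) ^ n) ** matrix_inv Q"
    using mpoch_neg[of M n] by (simp add: N Q_def)
  ultimately show ?thesis by (simp add: inv_eq)
qed

lemma mpoch_add_nat:
  fixes M :: "complex^'d^'d"
  assumes "mpoch_defined M"
  shows "mpoch M N ** mpoch_nat (M + mat (of_int N)) k = mpoch M (N + int k)"
proof (induction k)
  case (Suc k)
  have "mpoch M (N + int (Suc k)) = mpoch M (N + int k) ** (M + mat (of_int (N + int k)))"
    using mpoch_Suc_index[OF assms, of "N + int k"] by (simp add: ac_simps)
  also have "M + mat (of_int (N + int k)) = M + mat (of_int N) + mat (of_nat k)"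
    by (simp add: mat_add add.assoc)
  finally show ?case using Suc by (simp add: matrix_mul_assoc)
qed simp

lemma mpoch_nat_add:
  "mpoch_nat M m ** mpoch_nat (M + mat (of_nat m)) k = mpoch_nat M (m + k)"
proof (induction k)
  case (Suc k)
  have "M + mat (of_nat (m + k)) = M + mat (of_nat m) + mat (of_nat k)"
    by (simp add: mat_add add.assoc)
  then show ?case by (simp only: add_Suc_right mpoch_nat.simps matrix_mul_assoc Suc)
qed simp

text \<open>Splitting off the first factor instead of the last one. Both sides satisfy the same recursion
in \<open>N\<close>, so the claim spreads from \<open>N = 0\<close> in both directions.\<close>

lemma mpoch_shift_base:
  fixes M :: "complex^'d^'d"
  assumes "mpoch_defined M" "mpoch_defined (M + mat 1)"
  shows "M ** mpoch (M + mat 1) N = mpoch M (N + 1)"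
proof (induction N rule: int_induct[where k = 0])
  case base
  show ?case using mpoch_Suc_index[OF assms(1), of 0] by simp
next
  case (step1 N)
  have "M ** mpoch (M + mat 1) (N + 1) = mpoch M (N + 1) ** (M + mat 1 + mat (of_int N))"
    using step1 by (simp add: mpoch_Suc_index[OF assms(2)] matrix_mul_assoc)
  also have "M + mat 1 + mat (of_int N) = M + mat (of_int (N + 1))"
    by (simp add: mat_add add.assoc add.commute)
  finally show ?case by (simp only: mpoch_Suc_index[OF assms(1), of "N + 1"])
next
  case (step2 N)
  define F where "F = M + mat (of_int N)"
  have F': "F = M + mat 1 + mat (of_int (N - 1))"
    by (simp add: F_def mat_add add.assoc)
  \<comment> \<open>Going down requires cancelling \<open>F\<close>. Since \<open>N\<close> is at most \<open>0\<close>, it is one of the factors inverted in the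
    symbols of \<open>M + I\<close>; for \<open>N = 0\<close> it is \<open>M\<close> itself, which those of \<open>M\<close> do not cover.\<close>
  obtain n where "N = - int n" using step2(1) by (metis nonpos_int_cases)
  then have "F = M + mat 1 - mat (of_nat (Suc n))"
    by (simp add: F_def vec_eq_iff mat_component)
  then have inv: "invertible F" using invertible_mpoch_factor[OF assms(2), of n] by simp
  have "M ** mpoch (M + mat 1) (N - 1) ** F = M ** mpoch (M + mat 1) N"
    using mpoch_Suc_index[OF assms(2), of "N - 1"] by (simp add: F' matrix_mul_assoc)
  also have "\<dots> = mpoch M N ** F"
    using step2 mpoch_Suc_index[OF assms(1), of N] by (simp add: F_def)
  finally have "M ** mpoch (M + mat 1) (N - 1) ** F ** matrix_inv F = mpoch M N ** F ** matrix_inv F"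
    by simp
  then show ?case
    by (simp add: matrix_inv_inverse[OF inv] flip: matrix_mul_assoc)
qed

text \<open>Together with \<open>mpoch_add_nat\<close> this exchanges the order of a fixed shift by an integer \<open>N\<close> and
a shift by \<open>k\<close>, which is how the parameters \<open>B + kI\<close> arise.\<close>

lemma mpoch_nat_mult_mpoch:
  fixes M :: "complex^'d^'d"
  assumes "\<And>n::nat. mpoch_defined (M + mat (of_nat n))"
  shows "mpoch_nat M k ** mpoch (M + mat (of_nat k)) N = mpoch M (int k + N)"
proof (induction k arbitrary: N)
  case (Suc k)
  have eq: "M + mat (of_nat k) + mat 1 = M + mat (of_nat (Suc k))"
    by (simp add: mat_add add.assoc add.commute)
  have "mpoch_nat M (Suc k) ** mpoch (M + mat (of_nat (Suc k))) N
      = mpoch_nat M k ** ((M + mat (of_nat k)) ** mpoch (M + mat (of_nat k) + mat 1) N)"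
    by (simp add: matrix_mul_assoc eq del: of_nat_Suc)
  also have "\<dots> = mpoch_nat M k ** mpoch (M + mat (of_nat k)) (N + 1)"
    using assms[of k] assms[of "Suc k"] by (subst mpoch_shift_base) (simp_all add: eq del: of_nat_Suc)
  also have "\<dots> = mpoch M (int k + (N + 1))" by (rule Suc)
  finally show ?case by (simp add: ac_simps)
qed simp

section \<open>Operator norm and growth of Pochhammer symbols\<close>

text \<open>The operator norm is submultiplicative and gives scalar matrices the norm \<open>\<bar>c\<bar>\<close>, independently of the dimension.
The latter is essential for the growth estimates: the Frobenius norm of \<open>M + nI\<close> grows like \<open>n\<close> times the square root of \<open>d\<close>.\<close>

definition opnorm :: "complex^'d^'d \<Rightarrow> real" where
  "opnorm M = onorm ((*v) M)"

lemma opnorm_nonneg: "0 \<le> opnorm M"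
  unfolding opnorm_def by (rule onorm_pos_le) simp

lemma opnorm_mult: "opnorm (M ** N) \<le> opnorm M * opnorm N"
proof -
  have "(*v) (M ** N) = (*v) M \<circ> (*v) N"
    by (simp add: fun_eq_iff matrix_vector_mul_assoc)
  then show ?thesis unfolding opnorm_def by (simp add: onorm_compose)
qed

lemma opnorm_add: "opnorm (M + N) \<le> opnorm M + opnorm N"
proof -
  have "(*v) (M + N) = (\<lambda>x. M *v x + N *v x)"
    by (simp add: fun_eq_iff matrix_vector_mult_add_rdistrib)
  then show ?thesis unfolding opnorm_def by (simp add: onorm_triangle)
qed

lemma opnorm_mat_le: "opnorm (mat c :: complex^'d^'d) \<le> norm c"
  unfolding opnorm_def
proof (rule onorm_bound)
  fix x :: "complex^'d"
  have "(mat c *v x) $ i = c * x $ i" for i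
    by (simp add: matrix_vector_mult_def mat_component if_distrib if_distribR cong: if_cong)
  then show "norm (mat c *v x) \<le> norm c * norm x"
    by (simp add: norm_vec_def norm_mult L2_set_right_distrib)
qed simp

lemma opnorm_scale: "opnorm (mat c ** M) = norm c * opnorm M"
proof (rule antisym)
  show le: "opnorm (mat c ** M) \<le> norm c * opnorm M" for c :: complex and M :: "complex^'d^'d"
    using opnorm_mult[of "mat c" M] opnorm_mat_le[of c, where 'd='d] opnorm_nonneg[of M]
    by (meson mult_right_mono order_trans)
  show "norm c * opnorm M \<le> opnorm (mat c ** M)"
  proof (cases "c = 0")
    case False
    have "M = mat (inverse c) ** (mat c ** M)"
      using False by (simp add: matrix_mul_assoc mat_mult_mat)
    then have "opnorm M \<le> norm (inverse c) * opnorm (mat c ** M)"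
      using le[of "inverse c" "mat c ** M"] by simp
    then show ?thesis using False by (simp add: norm_inverse norm_divide field_simps)
  qed (simp add: opnorm_nonneg)
qed

lemma norm_component_le_opnorm: "norm (M $ i $ j) \<le> opnorm M"
proof -
  have "norm (M $ i $ j) = norm ((M *v axis j 1) $ i)"
    by (simp add: matrix_vector_mult_def axis_def if_distrib if_distribR cong: if_cong)
  also have "\<dots> \<le> norm (M *v axis j 1)" by (rule Finite_Cartesian_Product.norm_nth_le)
  also have "\<dots> \<le> opnorm M * norm (axis j (1::complex))"
    unfolding opnorm_def by (rule onorm) simp
  also have "norm (axis j (1::complex)) = 1"
    by (simp add: norm_vec_def L2_set_def axis_def if_distrib if_distribR cong: if_cong)
  finally show ?thesis by simp
qed

lemma opnorm_le_sum_components: "opnorm M \<le> (\<Sum>i\<in>UNIV. \<Sum>j\<in>UNIV. norm (M $ i $ j))"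
  unfolding opnorm_def
proof (rule onorm_bound)
  fix x
  have "norm (M *v x) \<le> (\<Sum>i\<in>UNIV. norm ((M *v x) $ i))"
    unfolding norm_vec_def by (rule L2_set_le_sum) simp
  also have "\<dots> \<le> (\<Sum>i\<in>UNIV. \<Sum>j\<in>UNIV. norm (M $ i $ j) * norm x)"
    unfolding matrix_vector_mult_def
    by (auto intro!: sum_mono norm_sum[THEN order_trans] mult_left_mono Finite_Cartesian_Product.norm_nth_le
        simp: norm_mult)
  finally show "norm (M *v x) \<le> (\<Sum>i\<in>UNIV. \<Sum>j\<in>UNIV. norm (M $ i $ j)) * norm x"
    by (simp add: sum_distrib_right)
qed (simp add: sum_nonneg)

text \<open>The form of the ratio test used below: the finitely many terms before the ratio bound sets in are
absorbed in the constant.\<close>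

lemma ratio_growth:
  fixes e :: "nat \<Rightarrow> real"
  assumes "\<And>n. 0 \<le> e n" "0 < \<rho>" "eventually (\<lambda>n. e (Suc n) \<le> \<rho> * e n) sequentially"
  obtains K where "0 \<le> K" "\<And>n. e n \<le> K * \<rho> ^ n"
proof -
  obtain N where N: "\<And>n. n \<ge> N \<Longrightarrow> e (Suc n) \<le> \<rho> * e n"
    using assms(3) by (auto simp: eventually_sequentially)
  define K where "K = (\<Sum>k\<le>N. e k / \<rho> ^ k)"
  have small: "e n \<le> K * \<rho> ^ n" if "n \<le> N" for n
  proof -
    have "e n / \<rho> ^ n \<le> K"
      unfolding K_def by (rule member_le_sum) (use assms(1,2) that in auto)
    then show ?thesis using assms(2) by (simp add: field_simps)
  qed
  have "e n \<le> K * \<rho> ^ n" for n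
  proof (induction n)
    case (Suc n)
    show ?case
    proof (cases "Suc n \<le> N")
      case False
      then have "e (Suc n) \<le> \<rho> * e n" using N by simp
      also have "\<dots> \<le> \<rho> * (K * \<rho> ^ n)" using Suc assms(2) by simp
      finally show ?thesis by (simp add: mult_ac)
    qed (rule small)
  qed (rule small, simp)
  moreover have "0 \<le> K" unfolding K_def using assms(1,2) by (auto intro!: sum_nonneg)
  ultimately show thesis using that by blast
qed

lemma eventually_linear_le:
  fixes a \<rho> :: real
  assumes "1 < \<rho>"
  shows "eventually (\<lambda>n. a + real n \<le> \<rho> * real n) sequentially"
proof -
  have "eventually (\<lambda>n. real n \<ge> a / (\<rho> - 1)) sequentially"
    using filterlim_real_sequentially by (simp add: filterlim_at_top)
  then show ?thesis
    by eventually_elim (use assms in \<open>simp add: field_simps\<close>)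
qed

lemma opnorm_mpoch_nat_Suc:
  "opnorm (mpoch_nat M (Suc n)) \<le> (opnorm M + real n) * opnorm (mpoch_nat M n)"
proof -
  have "opnorm (M + mat (of_nat n)) \<le> opnorm M + real n"
    using opnorm_add[of M "mat (of_nat n)"] opnorm_mat_le[of "of_nat n :: complex", where 'd='a] by simp
  then have "opnorm (mpoch_nat M n) * opnorm (M + mat (of_nat n))
      \<le> opnorm (mpoch_nat M n) * (opnorm M + real n)"
    by (rule mult_left_mono) (rule opnorm_nonneg)
  then show ?thesis
    using opnorm_mult[of "mpoch_nat M n" "M + mat (of_nat n)"] by (simp add: mult.commute)
qed

text \<open>The ratio of consecutive terms is at most \<open>(\<parallel>M\<parallel> + n) / (n + 1)\<close>, which tends to \<open>1\<close>.\<close>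

lemma mpoch_nat_growth:
  fixes M :: "complex^'d^'d"
  assumes "1 < \<rho>"
  obtains K where "0 \<le> K" "\<And>n. opnorm (mpoch_nat M n) / fact n \<le> K * \<rho> ^ n"
proof (rule ratio_growth[of "\<lambda>n. opnorm (mpoch_nat M n) / fact n" \<rho>])
  show "eventually (\<lambda>n. opnorm (mpoch_nat M (Suc n)) / fact (Suc n)
          \<le> \<rho> * (opnorm (mpoch_nat M n) / fact n)) sequentially"
    using eventually_linear_le[OF assms, of "opnorm M"]
  proof eventually_elim
    case (elim n)
    have "opnorm M + real n \<le> \<rho> * real (Suc n)"
      using elim assms by (simp add: algebra_simps)
    from mult_right_mono[OF this opnorm_nonneg[of "mpoch_nat M n"]]
    have "opnorm (mpoch_nat M (Suc n)) \<le> \<rho> * real (Suc n) * opnorm (mpoch_nat M n)"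
      using opnorm_mpoch_nat_Suc[of M n] by linarith
    then show ?case by (simp add: divide_simps mult_ac)
  qed
qed (use assms that in \<open>auto simp: opnorm_nonneg\<close>)

text \<open>From \<open>(M)\<^sub>-\<^sub>n = (M)\<^sub>-\<^sub>n\<^sub>-\<^sub>1 (M - (n + 1)I)\<close>: isolating the scalar part bounds \<open>(M)\<^sub>-\<^sub>n\<^sub>-\<^sub>1\<close> without any estimate of an
inverse matrix. The bound is useful as soon as \<open>n + 1\<close> exceeds the norm of \<open>M\<close>.\<close>

lemma opnorm_mpoch_neg_Suc:
  fixes M :: "complex^'d^'d"
  assumes "mpoch_defined M"
  shows "(real (Suc n) - opnorm M) * opnorm (mpoch M (- int (Suc n))) \<le> opnorm (mpoch M (- int n))"
proof -
  define P where "P = mpoch M (- int (Suc n))"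
  define Q where "Q = mpoch M (- int n)"
  have "Q = P ** (M + mat (of_int (- int (Suc n))))"
    using mpoch_Suc_index[OF assms, of "- int (Suc n)"] by (simp add: P_def Q_def)
  then have "mat (of_nat (Suc n)) ** P = P ** M + mat (-1) ** Q"
    by (simp add: vec_eq_iff matrix_add_ldistrib algebra_simps)
  then have "real (Suc n) * opnorm P \<le> opnorm (P ** M) + opnorm (mat (-1) ** Q)"
    by (metis opnorm_scale norm_of_nat opnorm_add)
  also have "\<dots> \<le> opnorm P * opnorm M + opnorm Q"
    using opnorm_mult[of P M] by (simp add: opnorm_scale)
  finally show ?thesis by (simp add: P_def Q_def algebra_simps)
qed

text \<open>One more factor multiplies the first norm by at most \<open>\<parallel>B\<parallel> + n\<close> and the second one by at most
\<open>1 / (n + 1 - \<parallel>B'\<parallel>)\<close>, so the ratio of consecutive products is bounded by a quantity that tends to \<open>1\<close>.\<close>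

lemma mpoch_pair_growth_nat:
  fixes B B' :: "complex^'d^'d"
  assumes "1 < \<rho>" "mpoch_defined B'"
  obtains K where "0 \<le> K"
    "\<And>n. opnorm (mpoch_nat B n) * opnorm (mpoch B' (- int n)) \<le> K * \<rho> ^ n"
proof (rule ratio_growth[of "\<lambda>n. opnorm (mpoch_nat B n) * opnorm (mpoch B' (- int n))" \<rho>])
  show "eventually (\<lambda>n. opnorm (mpoch_nat B (Suc n)) * opnorm (mpoch B' (- int (Suc n)))
          \<le> \<rho> * (opnorm (mpoch_nat B n) * opnorm (mpoch B' (- int n)))) sequentially"
    using eventually_linear_le[OF assms(1), of "opnorm B + \<rho> * opnorm B'"]
  proof eventually_elim
    case (elim n)
    let ?b = "opnorm (mpoch_nat B n)" and ?c = "opnorm (mpoch B' (- int (Suc n)))"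
    have "opnorm (mpoch_nat B (Suc n)) * ?c \<le> (opnorm B + real n) * ?b * ?c"
      by (intro mult_right_mono opnorm_mpoch_nat_Suc opnorm_nonneg)
    also have "\<dots> \<le> (\<rho> * (real (Suc n) - opnorm B')) * ?b * ?c"
      by (intro mult_right_mono opnorm_nonneg) (use elim assms(1) in \<open>simp add: algebra_simps\<close>)
    also have "\<dots> = \<rho> * ?b * ((real (Suc n) - opnorm B') * ?c)" by (simp add: mult_ac)
    also have "\<dots> \<le> \<rho> * ?b * opnorm (mpoch B' (- int n))"
      by (intro mult_left_mono opnorm_mpoch_neg_Suc assms) (use assms in \<open>simp add: opnorm_nonneg\<close>)
    finally show ?case by (simp add: mult_ac)
  qed
qed (use assms that in \<open>auto simp: opnorm_nonneg\<close>)

lemma mpoch_pair_growth: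
  fixes B B' :: "complex^'d^'d"
  assumes "1 < \<rho>" "mpoch_defined B" "mpoch_defined B'"
  obtains K where "0 \<le> K"
    "\<And>N. opnorm (mpoch B N) * opnorm (mpoch B' (- N)) \<le> K * \<rho> ^ nat \<bar>N\<bar>"
proof -
  obtain K1 where K1: "0 \<le> K1"
    "\<And>n. opnorm (mpoch_nat B n) * opnorm (mpoch B' (- int n)) \<le> K1 * \<rho> ^ n"
    using mpoch_pair_growth_nat[OF assms(1,3)] by blast
  obtain K2 where K2: "0 \<le> K2"
    "\<And>n. opnorm (mpoch_nat B' n) * opnorm (mpoch B (- int n)) \<le> K2 * \<rho> ^ n"
    using mpoch_pair_growth_nat[OF assms(1,2)] by blast
  have "opnorm (mpoch B N) * opnorm (mpoch B' (- N)) \<le> (K1 + K2) * \<rho> ^ nat \<bar>N\<bar>" for N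
  proof (cases N rule: int_cases2)
    case (nonneg n)
    then show ?thesis using K1(2)[of n] K2(1) assms(1)
      by (simp add: distrib_right add_increasing2)
  next
    case (nonpos n)
    then show ?thesis using K2(2)[of n] K1(1) assms(1)
      by (simp add: distrib_right add_increasing mult.commute)
  qed
  with K1(1) K2(1) show thesis by (intro that[of "K1 + K2"]) auto
qed

section \<open>Absolute convergence of the double series\<close>

lemma has_sum_vecI:
  fixes f :: "'a \<Rightarrow> 'b::real_normed_vector ^ 'n"
  assumes "\<And>i. ((\<lambda>x. f x $ i) has_sum s $ i) A"
  shows "(f has_sum s) A"
  using assms unfolding has_sum_def by (auto intro!: vec_tendstoI simp: sum_component)

lemma sums_vecI:
  fixes f :: "nat \<Rightarrow> 'b::real_normed_vector ^ 'n"
  assumes "\<And>i. (\<lambda>n. f n $ i) sums (s $ i)"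
  shows "f sums s"
  using assms unfolding sums_def by (auto intro!: vec_tendstoI simp: sum_component)

lemma has_sum_vec_nth:
  fixes f :: "'a \<Rightarrow> 'b::real_normed_vector ^ 'n"
  shows "(f has_sum s) A \<Longrightarrow> ((\<lambda>x. f x $ i) has_sum s $ i) A"
  by (rule has_sum_bounded_linear[OF bounded_linear_vec_nth])

definition horn_coeff ::
  "complex^'d^'d \<Rightarrow> complex^'d^'d \<Rightarrow> complex^'d^'d \<Rightarrow> nat \<Rightarrow> nat \<Rightarrow> complex^'d^'d" where
  "horn_coeff A B B' m n = mpoch_nat A m ** mpoch B (int n - int m) ** mpoch B' (int m - int n)"

text \<open>The exponent \<open>2m + n\<close> collects \<open>\<rho>\<^sup>m\<close> from \<open>(A)\<^sub>m / m!\<close> and \<open>\<rho>\<close> to the power \<open>\<bar>n - m\<bar> \<le> m + n\<close> from the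
other two symbols.\<close>

lemma opnorm_horn_coeff_le:
  fixes A B B' :: "complex^'d^'d"
  assumes "1 < \<rho>" "mpoch_defined B" "mpoch_defined B'"
  obtains K where "0 \<le> K" "\<And>m n. opnorm (horn_coeff A B B' m n) \<le> K * fact m * \<rho> ^ (2 * m + n)"
proof -
  obtain K1 where K1: "0 \<le> K1" "\<And>n. opnorm (mpoch_nat A n) / fact n \<le> K1 * \<rho> ^ n"
    using mpoch_nat_growth[OF assms(1)] by blast
  obtain K2 where K2: "0 \<le> K2" "\<And>N. opnorm (mpoch B N) * opnorm (mpoch B' (- N)) \<le> K2 * \<rho> ^ nat \<bar>N\<bar>"
    using mpoch_pair_growth[OF assms] by blast
  have "opnorm (horn_coeff A B B' m n) \<le> (K1 * K2) * fact m * \<rho> ^ (2 * m + n)" for m n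
  proof -
    let ?N = "int n - int m"
    have "opnorm (horn_coeff A B B' m n) \<le> opnorm (mpoch_nat A m) * opnorm (mpoch B ?N ** mpoch B' (- ?N))"
      using opnorm_mult[of "mpoch_nat A m" "mpoch B ?N ** mpoch B' (- ?N)"]
      by (simp add: horn_coeff_def matrix_mul_assoc)
    also have "\<dots> \<le> opnorm (mpoch_nat A m) * (opnorm (mpoch B ?N) * opnorm (mpoch B' (- ?N)))"
      by (intro mult_left_mono opnorm_mult opnorm_nonneg)
    also have "\<dots> \<le> (K1 * \<rho> ^ m * fact m) * (K2 * \<rho> ^ nat \<bar>?N\<bar>)"
      using K1(2)[of m] K1(1) assms(1)
      by (intro mult_mono K2(2)) (auto simp: field_simps intro!: mult_nonneg_nonneg opnorm_nonneg)
    also have "\<dots> \<le> (K1 * \<rho> ^ m * fact m) * (K2 * \<rho> ^ (m + n))"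
      using K1(1) K2(1) assms(1) by (intro mult_left_mono power_increasing) auto
    also have "\<dots> = (K1 * K2) * fact m * \<rho> ^ (2 * m + n)"
      by (simp add: power_add mult_2_right mult_ac)
    finally show ?thesis .
  qed
  with K1(1) K2(1) show thesis by (intro that[of "K1 * K2"]) auto
qed

lemma summable_on_product_nat:
  fixes a b :: "nat \<Rightarrow> real"
  assumes "summable a" "summable b" "\<And>n. 0 \<le> a n" "\<And>n. 0 \<le> b n"
  shows "(\<lambda>(m, n). a m * b n) summable_on UNIV"
proof -
  have "(b has_sum suminf b) UNIV"
    using assms by (intro norm_summable_imp_has_sum) (auto simp: summable_sums)
  then have "((\<lambda>n. a m * b n) has_sum a m * suminf b) UNIV" for m
    by (rule has_sum_cmult_right)
  moreover have "(\<lambda>m. a m * suminf b) summable_on UNIV"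
    using assms by (intro norm_summable_imp_summable_on) (auto intro!: summable_mult2 simp: suminf_nonneg)
  ultimately have "(\<lambda>(m, n). a m * b n) summable_on (SIGMA m:UNIV. UNIV)"
    by (intro summable_on_SigmaI[where g = "\<lambda>m. a m * suminf b"]) (use assms in auto)
  then show ?thesis by simp
qed

text \<open>The factor \<open>m!\<close> in the bound for \<open>(A)\<^sub>m\<close> eats the one in the denominator, which leaves a
geometric series in \<open>m\<close> and an exponential series in \<open>n\<close>.\<close>

lemma horn_majorant_summable:
  fixes A B B' :: "complex^'d^'d"
  assumes "mpoch_defined B" "mpoch_defined B'" "0 \<le> q" "q < 1" "0 \<le> Y"
  shows "(\<lambda>(m, n). q ^ m * Y ^ n / (fact m * fact n) * opnorm (horn_coeff A B B' m n)) summable_on UNIV"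
proof -
  \<comment> \<open>Chosen so that \<open>\<rho>\<^sup>2 q = 2q / (1 + q) < 1\<close>.\<close>
  define \<rho> where "\<rho> = sqrt (2 / (1 + q))"
  have \<rho>: "1 < \<rho>" "\<rho>\<^sup>2 * q < 1" using assms by (auto simp: \<rho>_def field_simps)
  obtain K where K: "0 \<le> K" "\<And>m n. opnorm (horn_coeff A B B' m n) \<le> K * fact m * \<rho> ^ (2 * m + n)"
    using opnorm_horn_coeff_le[OF \<rho>(1) assms(1,2)] by blast
  have "(\<lambda>(m, n). (K * (\<rho>\<^sup>2 * q) ^ m) * ((\<rho> * Y) ^ n / fact n)) summable_on UNIV"
  proof (rule summable_on_product_nat)
    show "summable (\<lambda>m. K * (\<rho>\<^sup>2 * q) ^ m)"
      using \<rho> assms by (intro summable_mult summable_geometric) auto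
    show "summable (\<lambda>n. (\<rho> * Y) ^ n / fact n)"
      using summable_exp[of "\<rho> * Y"] by (simp add: divide_inverse mult.commute)
  qed (use K(1) \<rho>(1) assms in auto)
  then show ?thesis
  proof (rule summable_on_comparison_test)
    fix p :: "nat \<times> nat"
    obtain m n where p: "p = (m, n)" by fastforce
    have "q ^ m * Y ^ n / (fact m * fact n) * opnorm (horn_coeff A B B' m n)
        \<le> q ^ m * Y ^ n / (fact m * fact n) * (K * fact m * \<rho> ^ (2 * m + n))"
      using assms by (intro mult_left_mono K) auto
    also have "\<dots> = (K * (\<rho>\<^sup>2 * q) ^ m) * ((\<rho> * Y) ^ n / fact n)"
      by (simp add: power_add power_mult power_mult_distrib)
    finally show "(case p of (m, n) \<Rightarrow> q ^ m * Y ^ n / (fact m * fact n) * opnorm (horn_coeff A B B' m n))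
        \<le> (case p of (m, n) \<Rightarrow> (K * (\<rho>\<^sup>2 * q) ^ m) * ((\<rho> * Y) ^ n / fact n))"
      by (simp add: p)
    show "0 \<le> (case p of (m, n) \<Rightarrow> q ^ m * Y ^ n / (fact m * fact n) * opnorm (horn_coeff A B B' m n))"
      using assms by (auto simp: p opnorm_nonneg)
  qed
qed

lemma Horn_Gamma1_has_sum:
  fixes A B B' :: "complex^'d^'d"
  assumes "mpoch_defined B" "mpoch_defined B'" "norm x < 1"
  shows "((\<lambda>(m, n). mat (x ^ m * y ^ n / (fact m * fact n)) ** horn_coeff A B B' m n)
           has_sum Horn_Gamma1 A B B' x y) UNIV"
proof -
  let ?f = "\<lambda>(m, n). mat (x ^ m * y ^ n / (fact m * fact n)) ** horn_coeff A B B' m n"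
  let ?s = "\<chi> i j. \<Sum>\<^sub>\<infinity>p. ?f p $ i $ j"
  have "(\<lambda>p. norm (?f p $ i $ j)) summable_on UNIV" for i j
  proof (rule Infinite_Sum.abs_summable_on_comparison_test')
    show "(\<lambda>(m, n). norm x ^ m * norm y ^ n / (fact m * fact n) * opnorm (horn_coeff A B B' m n)) summable_on UNIV"
      using assms by (intro horn_majorant_summable) auto
    show "norm (?f p $ i $ j) \<le> (case p of (m, n) \<Rightarrow>
        norm x ^ m * norm y ^ n / (fact m * fact n) * opnorm (horn_coeff A B B' m n))" for p
      by (cases p) (auto simp: norm_mult norm_divide norm_power norm_component_le_opnorm intro!: mult_left_mono divide_right_mono)
  qed
  then have "((\<lambda>p. ?f p $ i $ j) has_sum ?s $ i $ j) UNIV" for i j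
    by (simp add: abs_summable_summable has_sum_infsum)
  then have s: "(?f has_sum ?s) UNIV" by (intro has_sum_vecI)
  have "Horn_Gamma1 A B B' x y = infsum ?f UNIV"
    by (simp add: Horn_Gamma1_def horn_coeff_def)
  also have "\<dots> = ?s" using s by (rule infsumI)
  finally have eq: "Horn_Gamma1 A B B' x y = ?s" .
  show ?thesis unfolding eq by (rule s)
qed

section \<open>The matrix power of 1 - t\<close>

lemma mpowr_summable_component:
  fixes M :: "complex^'d^'d"
  assumes "norm t < 1"
  shows "summable (\<lambda>n. t ^ n / fact n * mpoch_nat M n $ i $ j)"
proof -
  \<comment> \<open>Chosen so that \<open>\<rho> \<bar>t\<bar> < 1\<close>.\<close>
  define \<rho> where "\<rho> = 2 / (1 + norm t)"
  have \<rho>: "1 < \<rho>" "\<rho> * norm t < 1"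
    using assms by (auto simp: \<rho>_def field_simps add_pos_nonneg)
  obtain K where K: "0 \<le> K" "\<And>n. opnorm (mpoch_nat M n) / fact n \<le> K * \<rho> ^ n"
    using mpoch_nat_growth[OF \<rho>(1)] by blast
  show ?thesis
  proof (rule summable_comparison_test'[where N = 0])
    show "summable (\<lambda>n. K * (\<rho> * norm t) ^ n)"
      using \<rho> by (intro summable_mult summable_geometric) auto
    fix n :: nat
    have "norm (t ^ n / fact n * mpoch_nat M n $ i $ j) = norm t ^ n * (norm (mpoch_nat M n $ i $ j) / fact n)"
      by (simp add: norm_mult norm_divide norm_power)
    also have "\<dots> \<le> norm t ^ n * (K * \<rho> ^ n)"
      by (intro mult_left_mono order_trans[OF _ K(2)] divide_right_mono norm_component_le_opnorm) auto
    finally show "norm (t ^ n / fact n * mpoch_nat M n $ i $ j) \<le> K * (\<rho> * norm t) ^ n"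
      by (simp add: power_mult_distrib mult_ac)
  qed
qed

lemma mpowr_sums:
  fixes M :: "complex^'d^'d"
  assumes "norm t < 1"
  shows "(\<lambda>n. mat (t ^ n / fact n) ** mpoch_nat M n) sums one_minus_mpowr t M"
proof -
  have "(\<lambda>n. mat (t ^ n / fact n) ** mpoch_nat M n) sums
      (\<chi> i j. \<Sum>n. t ^ n / fact n * mpoch_nat M n $ i $ j)"
    using summable_sums[OF mpowr_summable_component[OF assms]] by (intro sums_vecI) simp
  then show ?thesis unfolding one_minus_mpowr_def by (simp add: sums_iff)
qed

lemma mpowr_component_sums:
  fixes M :: "complex^'d^'d"
  assumes "norm t < 1"
  shows "(\<lambda>n. mpoch_nat M n $ i $ j / fact n * t ^ n) sums (one_minus_mpowr t M $ i $ j)"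
  using sums_vec_nth[OF sums_vec_nth[OF mpowr_sums[OF assms]], of M i j] by (simp add: mult_ac)

lemma mpowr_component_holomorphic:
  fixes M :: "complex^'d^'d"
  shows "(\<lambda>t. one_minus_mpowr t M $ i $ j) holomorphic_on ball 0 1"
proof (rule power_series_holomorphic)
  fix t :: complex assume "t \<in> ball 0 1"
  then show "(\<lambda>n. mpoch_nat M n $ i $ j / fact n * (t - 0) ^ n) sums (one_minus_mpowr t M $ i $ j)"
    using mpowr_component_sums[of t M i j] by simp
qed

text \<open>Multiplying a power series by \<open>1 - t\<close> takes differences of consecutive coefficients, and
\<open>(M + I)\<^sub>n\<^sub>+\<^sub>1 - (n + 1)(M + I)\<^sub>n = (M + I)\<^sub>n M = (M)\<^sub>n\<^sub>+\<^sub>1\<close>.\<close>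

lemma mpowr_shift:
  fixes M :: "complex^'d^'d"
  assumes "norm t < 1"
  shows "one_minus_mpowr t M = mat (1 - t) ** one_minus_mpowr t (M + mat 1)"
proof -
  let ?N = "M + mat 1"
  have N_Suc: "mpoch_nat ?N (Suc n) = mpoch_nat M (Suc n) + mat (of_nat (Suc n)) ** mpoch_nat ?N n" for n
  proof -
    have "mpoch_nat ?N (Suc n) = mpoch_nat ?N n ** (M + mat (of_nat (Suc n)))"
      by (simp add: mat_add add.assoc)
    also have "\<dots> = mpoch_nat ?N n ** M + mat (of_nat (Suc n)) ** mpoch_nat ?N n"
      by (simp add: matrix_add_ldistrib mult_mat del: of_nat_Suc)
    also have "mpoch_nat ?N n ** M = M ** mpoch_nat ?N n"
      by (rule commutes_mpoch_nat[symmetric]) (simp add: commutes_add_mat)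
    also have "\<dots> = mpoch_nat M (Suc n)"
      using mpoch_nat_add[of M 1 n] by (simp add: vec_eq_iff mat_component matrix_add_ldistrib)
    finally show ?thesis .
  qed
  have "one_minus_mpowr t M $ i $ j = (1 - t) * one_minus_mpowr t ?N $ i $ j" for i j
  proof -
    define a where "a = (\<lambda>n. mpoch_nat M n $ i $ j / fact n * t ^ n)"
    define b where "b = (\<lambda>n. mpoch_nat ?N n $ i $ j / fact n * t ^ n)"
    let ?E = "one_minus_mpowr t ?N $ i $ j"
    have b: "b sums ?E" unfolding b_def by (rule mpowr_component_sums[OF assms])
    then have "(\<lambda>n. b (Suc n)) sums (?E - b 0)" by (subst sums_Suc_iff) simp
    from sums_diff[OF this sums_mult[OF b, of t]]
    have "(\<lambda>n. b (Suc n) - t * b n) sums (?E - b 0 - t * ?E)" .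
    also have "(\<lambda>n. b (Suc n) - t * b n) = (\<lambda>n. a (Suc n))"
    proof
      fix n
      have arith: "(u + k * v) / (k * F) * (t * T) - t * (v / F * T) = u / (k * F) * (t * T)"
        if "k \<noteq> 0" "F \<noteq> 0" for u v k F T :: complex
        using that by (simp add: field_simps)
      show "b (Suc n) - t * b n = a (Suc n)"
        using arith[of "of_nat (Suc n)" "fact n" "mpoch_nat M (Suc n) $ i $ j" "mpoch_nat ?N n $ i $ j" "t ^ n"]
        unfolding a_def b_def N_Suc fact_Suc power_Suc vector_add_component mat_mult_component
        by (simp del: mpoch_nat.simps of_nat_Suc)
    qed
    finally have "a sums (?E - b 0 - t * ?E + a 0)" by (subst (asm) sums_Suc_iff)
    moreover have "a sums (one_minus_mpowr t M $ i $ j)"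
      unfolding a_def by (rule mpowr_component_sums[OF assms])
    moreover have "a 0 = b 0" by (simp add: a_def b_def)
    ultimately show ?thesis by (auto dest: sums_unique2 simp: algebra_simps)
  qed
  then show ?thesis by (simp add: vec_eq_iff)
qed

text \<open>The law of exponents \<open>(1 - t)\<^bsup>-(M + eI)\<^esup> = (1 - t)\<^bsup>-e\<^esup> (1 - t)\<^bsup>-M\<^esup>\<close>, which absorbs the scalar powers of
\<open>1 - t\<close> into the matrix exponent.\<close>

lemma mpowr_add_int:
  fixes M :: "complex^'d^'d"
  assumes "norm t < 1"
  shows "one_minus_mpowr t (M + mat (of_int e)) = mat ((1 - t) powi (- e)) ** one_minus_mpowr t M"
proof -
  have t1: "1 - t \<noteq> 0" using assms by auto
  have step: "one_minus_mpowr t (M + mat (of_int e))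
      = mat (1 - t) ** one_minus_mpowr t (M + mat (of_int (e + 1)))" for e
    using mpowr_shift[OF assms, of "M + mat (of_int e)"] by (simp add: mat_add add.assoc)
  have main: "mat ((1 - t) powi e) ** one_minus_mpowr t (M + mat (of_int e)) = one_minus_mpowr t M"
  proof (induction e rule: int_induct[where k = 0])
    case base
    show ?case by simp
  next
    case (step1 e)
    have "(1 - t) powi (e + 1) = (1 - t) powi e * (1 - t)" using t1 by (simp add: power_int_add)
    then show ?case using step1 step[of e] by (simp add: matrix_mul_assoc mat_mult_mat)
  next
    case (step2 e)
    have "(1 - t) powi e = (1 - t) powi (e - 1) * (1 - t)"
      using t1 power_int_add[of "1 - t" "e - 1" 1] by simp
    then show ?case using step2 step[of "e - 1"] by (simp add: matrix_mul_assoc mat_mult_mat)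
  qed
  have "mat ((1 - t) powi (- e)) ** one_minus_mpowr t M
      = mat ((1 - t) powi (- e)) ** mat ((1 - t) powi e) ** one_minus_mpowr t (M + mat (of_int e))"
    unfolding main[symmetric] by (rule matrix_mul_assoc)
  also have "\<dots> = one_minus_mpowr t (M + mat (of_int e))"
    using t1 by (simp add: mat_mult_mat power_int_minus)
  finally show ?thesis ..
qed

section \<open>Series of holomorphic functions and Taylor series beyond their disc\<close>

lemma higher_deriv_power_series:
  fixes f :: "complex \<Rightarrow> complex"
  assumes "0 < r" "\<And>t. norm t < r \<Longrightarrow> (\<lambda>k. c k * t ^ k) sums f t"
  shows "(deriv ^^ k) f 0 = fact k * c k"
proof -
  have "eventually (\<lambda>t. t \<in> ball 0 r) (nhds 0)"
    using assms(1) by (intro eventually_nhds_in_open) auto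
  then have "f has_fps_expansion Abs_fps c"
    by (intro has_fps_expansionI) (auto elim!: eventually_mono simp: assms(2))
  then show ?thesis
    using fps_nth_fps_expansion[of f "Abs_fps c" k] by simp
qed

lemma higher_deriv_sum:
  fixes f :: "'a \<Rightarrow> complex \<Rightarrow> complex"
  assumes "open S" "z \<in> S" "finite A" "\<And>p. p \<in> A \<Longrightarrow> f p holomorphic_on S"
  shows "(deriv ^^ k) (\<lambda>w. \<Sum>p\<in>A. f p w) z = (\<Sum>p\<in>A. (deriv ^^ k) (f p) z)"
  using assms(3,4)
proof (induction A rule: finite_induct)
  case empty
  then show ?case by simp
next
  case (insert q A)
  then show ?case
    using higher_deriv_add[of "f q" S "\<lambda>w. \<Sum>p\<in>A. f p w" z k] assms(1,2)
    by (simp add: holomorphic_on_sum)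
qed

text \<open>Weierstrass' theorem on locally uniform limits, for sums over an arbitrary index set with a local
summable majorant; the sum over finite index sets is a net converging along \<open>finite_subsets_at_top\<close>.\<close>

lemma infsum_holomorphic:
  fixes T :: "'a \<Rightarrow> complex \<Rightarrow> complex"
  assumes "open \<Omega>" and hol: "\<And>p. T p holomorphic_on \<Omega>"
    and dom: "\<And>z. z \<in> \<Omega> \<Longrightarrow> \<exists>U M. open U \<and> z \<in> U \<and> U \<subseteq> \<Omega> \<and> M summable_on UNIV \<and>
               (\<forall>p. \<forall>t\<in>U. norm (T p t) \<le> M p)"
  shows "(\<lambda>t. \<Sum>\<^sub>\<infinity>p. T p t) holomorphic_on \<Omega>"
    and "z \<in> \<Omega> \<Longrightarrow> ((\<lambda>p. (deriv ^^ k) (T p) z) has_sum (deriv ^^ k) (\<lambda>t. \<Sum>\<^sub>\<infinity>p. T p t) z) UNIV"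
proof -
  let ?F = "\<lambda>t. \<Sum>\<^sub>\<infinity>p. T p t"
  have lim: "\<exists>U. open U \<and> z \<in> U \<and> U \<subseteq> \<Omega> \<and>
      uniform_limit U (\<lambda>X t. \<Sum>p\<in>X. T p t) ?F (finite_subsets_at_top UNIV)" if z: "z \<in> \<Omega>" for z
  proof -
    obtain U M where U: "open U" "z \<in> U" "U \<subseteq> \<Omega>" and M: "M summable_on UNIV"
      "\<And>p t. t \<in> U \<Longrightarrow> norm (T p t) \<le> M p"
      using dom[OF z] by blast
    have "uniform_limit U (\<lambda>X t. \<Sum>p\<in>X. T p t) ?F (finite_subsets_at_top UNIV)"
      by (rule Weierstrass_m_test_general[OF M(2) M(1)]) auto
    with U show ?thesis by blast
  qed
  show "?F holomorphic_on \<Omega>"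
    unfolding holomorphic_on_def
  proof
    fix z assume "z \<in> \<Omega>"
    then obtain U where U: "open U" "z \<in> U" "U \<subseteq> \<Omega>"
      "uniform_limit U (\<lambda>X t. \<Sum>p\<in>X. T p t) ?F (finite_subsets_at_top UNIV)"
      using lim by blast
    obtain r where r: "0 < r" "cball z r \<subseteq> U" using U(1,2) open_contains_cball by blast
    have "(\<lambda>t. \<Sum>p\<in>X. T p t) holomorphic_on cball z r" for X
      using r(2) U(3) by (intro holomorphic_on_sum holomorphic_on_subset[OF hol]) auto
    then have "continuous_on (cball z r) (\<lambda>t. \<Sum>p\<in>X. T p t) \<and> (\<lambda>t. \<Sum>p\<in>X. T p t) holomorphic_on ball z r" for X
      using ball_subset_cball holomorphic_on_imp_continuous_on holomorphic_on_subset by blast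
    then have ev: "eventually (\<lambda>X. continuous_on (cball z r) (\<lambda>t. \<Sum>p\<in>X. T p t) \<and>
        (\<lambda>t. \<Sum>p\<in>X. T p t) holomorphic_on ball z r) (finite_subsets_at_top UNIV)"
      by (intro always_eventually allI)
    have "?F holomorphic_on ball z r"
      by (rule holomorphic_uniform_limit[OF ev uniform_limit_on_subset[OF U(4) r(2)]]) simp_all
    then show "?F field_differentiable at z within \<Omega>"
      using r(1) holomorphic_on_imp_differentiable_at[of ?F "ball z r" z]
        field_differentiable_at_within by auto
  qed
  assume "z \<in> \<Omega>"
  then obtain U where U: "open U" "z \<in> U" "U \<subseteq> \<Omega>"
    "uniform_limit U (\<lambda>X t. \<Sum>p\<in>X. T p t) ?F (finite_subsets_at_top UNIV)"
    using lim by blast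
  have hol': "T p holomorphic_on U" for p using hol U(3) holomorphic_on_subset by blast
  have "((\<lambda>X. (deriv ^^ k) (\<lambda>t. \<Sum>p\<in>X. T p t) z) \<longlongrightarrow> (deriv ^^ k) ?F z) (finite_subsets_at_top UNIV)"
    by (rule higher_deriv_complex_uniform_limit[OF U(4)])
      (auto intro!: always_eventually holomorphic_on_sum hol' U)
  moreover have "eventually (\<lambda>X. (deriv ^^ k) (\<lambda>t. \<Sum>p\<in>X. T p t) z = (\<Sum>p\<in>X. (deriv ^^ k) (T p) z))
      (finite_subsets_at_top UNIV)"
    by (rule eventually_finite_subsets_at_top_weakI) (intro higher_deriv_sum[OF U(1,2)] hol')
  ultimately show "((\<lambda>p. (deriv ^^ k) (T p) z) has_sum (deriv ^^ k) ?F z) UNIV"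
    unfolding has_sum_def by (simp cong: tendsto_cong)
qed

text \<open>With the tails \<open>r\<^sub>n = a\<^sub>n + a\<^sub>n\<^sub>+\<^sub>1 + \<dots>\<close>, summation by parts writes the error at \<open>s\<close> as
\<open>(1 - s) \<Sum> r\<^sub>n\<^sub>+\<^sub>1 s\<^sup>n\<close>. The late tails are small and \<open>(1 - s) \<Sum> s\<^sup>n = 1\<close>, while the early
ones contribute finitely many terms, which the factor \<open>1 - s\<close> kills.\<close>

lemma Abel_limit:
  fixes a :: "nat \<Rightarrow> complex"
  assumes "a sums S"
  shows "((\<lambda>s::real. \<Sum>n. a n * of_real s ^ n) \<longlongrightarrow> S) (at_left 1)"
proof -
  define r where "r = (\<lambda>n. S - (\<Sum>k<n. a k))"
  have r0: "r \<longlonglongrightarrow> 0"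
    using assms tendsto_diff[OF tendsto_const, of "\<lambda>n. \<Sum>k<n. a k" S sequentially S]
    by (simp add: r_def sums_def)
  have "Bseq r" using r0 convergentI convergent_imp_Bseq by blast
  then obtain C where C: "0 < C" "\<And>n. norm (r n) \<le> C" unfolding Bseq_def by blast
  have error: "(\<lambda>n. r (Suc n) * of_real s ^ n * (1 - of_real s)) sums
      (S - (\<Sum>n. a n * of_real s ^ n))" and
    normsum: "summable (\<lambda>n. norm (r (Suc n) * of_real s ^ n))"
    if s: "0 < s" "s < 1" for s :: real
  proof -
    have "summable (\<lambda>n. norm (r n * of_real s ^ n))"
    proof (rule summable_comparison_test'[where N = 0])
      show "summable (\<lambda>n. C * s ^ n)" using s by (intro summable_mult summable_geometric) auto
      show "norm (norm (r n * of_real s ^ n)) \<le> C * s ^ n" for n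
        using s C by (simp add: norm_mult norm_power mult_right_mono)
    qed
    then have sr: "summable (\<lambda>n. r n * of_real s ^ n)" by (rule summable_norm_cancel)
    have "summable (\<lambda>n. a n * 1 ^ n)" using assms by (simp add: sums_iff)
    then have "summable (\<lambda>n. a n * of_real s ^ n)"
      by (rule powser_inside) (use s in auto)
    then have sa: "(\<lambda>n. a n * of_real s ^ n) sums (\<Sum>n. a n * of_real s ^ n)" by (rule summable_sums)
    show "summable (\<lambda>n. norm (r (Suc n) * of_real s ^ n))"
    proof (rule summable_comparison_test'[where N = 0])
      show "summable (\<lambda>n. C * s ^ n)" using s by (intro summable_mult summable_geometric) auto
      show "norm (norm (r (Suc n) * of_real s ^ n)) \<le> C * s ^ n" for n
        using s C by (simp add: norm_mult norm_power mult_right_mono)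
    qed
    then have sr': "summable (\<lambda>n. r (Suc n) * of_real s ^ n)" by (rule summable_norm_cancel)
    define R where "R = (\<Sum>n. r (Suc n) * of_real s ^ n)"
    have R: "(\<lambda>n. r (Suc n) * of_real s ^ n) sums R" unfolding R_def by (rule summable_sums[OF sr'])
    have "(\<lambda>n. r (Suc n) * of_real s ^ Suc n) sums (of_real s * R)"
      using sums_mult[OF R, of "of_real s"] by (simp add: mult_ac)
    then have "(\<lambda>n. r n * of_real s ^ n) sums (of_real s * R + r 0)"
      by (subst (asm) sums_Suc_iff) simp
    from sums_diff[OF this R]
    have "(\<lambda>n. (r n - r (Suc n)) * of_real s ^ n) sums (of_real s * R + r 0 - R)"
      by (simp add: left_diff_distrib)
    then have "(\<lambda>n. a n * of_real s ^ n) sums (of_real s * R + r 0 - R)"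
      by (simp add: r_def)
    with sa have "(\<Sum>n. a n * of_real s ^ n) = of_real s * R + S - R"
      using sums_unique2 by (fastforce simp: r_def)
    then have "S - (\<Sum>n. a n * of_real s ^ n) = R * (1 - of_real s)"
      by (simp add: algebra_simps)
    then show "(\<lambda>n. r (Suc n) * of_real s ^ n * (1 - of_real s)) sums (S - (\<Sum>n. a n * of_real s ^ n))"
      using sums_mult2[OF R] by simp
  qed
  show ?thesis
  proof (rule tendstoI)
    fix e :: real assume "0 < e"
    then obtain N where N: "\<And>n. n \<ge> N \<Longrightarrow> norm (r n) < e / 2"
      using r0 unfolding LIMSEQ_iff by (metis half_gt_zero diff_zero)
    have "((\<lambda>s::real. (1 - s) * (C * real N)) \<longlongrightarrow> (1 - 1) * (C * real N)) (at_left 1)"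
      by (intro tendsto_intros)
    then have "eventually (\<lambda>s::real. (1 - s) * (C * real N) < e / 2) (at_left 1)"
      using \<open>0 < e\<close> by (intro order_tendstoD(2)) auto
    moreover have "eventually (\<lambda>s::real. 0 < s \<and> s < 1) (at_left 1)"
      using eventually_at_left_real[of 0 "1::real"] by (auto elim: eventually_mono)
    ultimately show "eventually (\<lambda>s. dist (\<Sum>n. a n * of_real s ^ n) S < e) (at_left 1)"
    proof eventually_elim
      case (elim s)
      have geo: "(\<lambda>n. e / 2 * s ^ n * (1 - s)) sums (e / 2)"
      proof -
        have "norm s < 1" using elim by simp
        from sums_mult2[OF sums_mult[OF geometric_sums[OF this], of "e / 2"], of "1 - s"]
        have "(\<lambda>n. e / 2 * s ^ n * (1 - s)) sums (e / 2 * (1 / (1 - s)) * (1 - s))" .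
        moreover have "1 / u * u = 1" if "u \<noteq> 0" for u :: real using that by simp
        then have "e / 2 * (1 / (1 - s)) * (1 - s) = e / 2" using elim by (simp only: mult.assoc) simp
        ultimately show ?thesis by metis
      qed
      have fin: "(\<lambda>n. if n \<in> {..<N} then C * (1 - s) else 0) sums (\<Sum>n<N. C * (1 - s))"
        by (rule sums_If_finite_set) simp
      \<comment> \<open>The first \<open>N\<close> tails are only bounded by \<open>C\<close>, the others by \<open>e / 2\<close>.\<close>
      have bound: "norm (r (Suc n) * of_real s ^ n * (1 - of_real s))
          \<le> (if n \<in> {..<N} then C * (1 - s) else 0) + e / 2 * s ^ n * (1 - s)" for n
      proof -
        have eq: "norm (r (Suc n) * of_real s ^ n * (1 - of_real s)) = norm (r (Suc n)) * s ^ n * (1 - s)"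
        proof -
          have "norm (1 - complex_of_real s) = norm (complex_of_real (1 - s))" by simp
          also have "\<dots> = 1 - s" unfolding norm_of_real using elim by simp
          finally show ?thesis using elim by (simp add: norm_mult norm_power)
        qed
        show ?thesis
        proof (cases "n < N")
          case True
          have "norm (r (Suc n)) * s ^ n \<le> C * 1"
            using elim C by (intro mult_mono) (auto simp: power_le_one)
          then have "norm (r (Suc n)) * s ^ n * (1 - s) \<le> C * (1 - s)"
            using elim by (simp add: mult_right_mono)
          moreover have "0 \<le> e / 2 * s ^ n * (1 - s)" using elim \<open>0 < e\<close> by simp
          ultimately show ?thesis using True eq by simp
        next
          case False
          then have "norm (r (Suc n)) \<le> e / 2" using N[of "Suc n"] by simp
          then have "norm (r (Suc n)) * s ^ n * (1 - s) \<le> e / 2 * s ^ n * (1 - s)"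
            using elim by (intro mult_right_mono) auto
          then show ?thesis using False eq by simp
        qed
      qed
      have "norm (S - (\<Sum>n. a n * of_real s ^ n)) \<le> (\<Sum>n<N. C * (1 - s)) + e / 2"
        using norm_suminf_le[OF bound sums_summable[OF sums_add[OF fin geo]]]
          sums_unique[OF error] sums_unique[OF sums_add[OF fin geo]] elim by simp
      also have "(\<Sum>n<N. C * (1 - s)) = (1 - s) * (C * real N)" by simp
      also have "\<dots> + e / 2 < e" using elim by linarith
      finally show ?case by (simp add: dist_norm norm_minus_commute)
    qed
  qed
qed

text \<open>Here \<open>t\<close> may lie on the boundary of the disc of convergence, and the part of \<open>\<Omega>\<close> inside the disc need not be
star-shaped. The power series and \<open>f\<close> agree near \<open>0\<close>, hence on the connected set; it contains the end of the
segment from \<open>0\<close> to \<open>t\<close>, along which Abel's theorem gives the value at \<open>t\<close>.\<close>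

lemma taylor_series_eq:
  fixes f :: "complex \<Rightarrow> complex"
  assumes hol: "f holomorphic_on \<Omega>" and \<Omega>: "open \<Omega>" "0 \<in> \<Omega>" "t \<in> \<Omega>"
    and conn: "connected (\<Omega> \<inter> ball 0 (norm t))"
    and summ: "(\<lambda>k. (deriv ^^ k) f 0 / fact k * t ^ k) sums S"
  shows "f t = S"
proof (cases "t = 0")
  case True
  then show ?thesis
    using sums_unique2[OF summ] powser_sums_zero[of "\<lambda>k. (deriv ^^ k) f 0 / fact k"] by simp
next
  case False
  define c where "c = (\<lambda>k. (deriv ^^ k) f 0 / fact k)"
  define g where "g = (\<lambda>w. \<Sum>k. c k * w ^ k)"
  let ?D = "ball 0 (norm t) :: complex set"
  have g: "(\<lambda>k. c k * w ^ k) sums g w" if "norm w < norm t" for w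
    unfolding g_def
    by (rule summable_sums, rule powser_inside[where x = t])
      (use summ that in \<open>auto simp: c_def sums_iff\<close>)
  have g_hol: "g holomorphic_on ?D"
    by (rule power_series_holomorphic[where a = c]) (use g in auto)
  obtain r where r: "0 < r" "ball 0 r \<subseteq> \<Omega>" using \<Omega> open_contains_ball by blast
  have near0: "f w = g w" if "w \<in> ball 0 (min r (norm t))" for w
  proof -
    have "(\<lambda>k. c k * w ^ k) sums f w"
      using holomorphic_power_series[OF holomorphic_on_subset[OF hol r(2)], of w] that
      by (simp add: c_def)
    with g[of w] that show ?thesis by (auto intro: sums_unique2)
  qed
  have eq: "f w = g w" if "w \<in> \<Omega> \<inter> ?D" for w
  proof (rule analytic_continuation_open[OF _ _ _ conn _ _ _ near0])
    show "ball 0 (min r (norm t)) \<noteq> {}" using r(1) False by (simp add: min_def)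
    show "f holomorphic_on \<Omega> \<inter> ?D" using hol holomorphic_on_subset by blast
    show "g holomorphic_on \<Omega> \<inter> ?D" using g_hol holomorphic_on_subset by blast
  qed (use that \<Omega> r in auto)
  have "((\<lambda>s::real. \<Sum>k. (c k * t ^ k) * of_real s ^ k) \<longlongrightarrow> S) (at_left 1)"
    by (rule Abel_limit) (use summ in \<open>simp add: c_def\<close>)
  then have lim_g: "((\<lambda>s::real. g (of_real s * t)) \<longlongrightarrow> S) (at_left 1)"
    by (simp add: g_def power_mult_distrib mult_ac)
  have path: "((\<lambda>s::real. of_real s * t) \<longlongrightarrow> of_real 1 * t) (at_left 1)"
    by (intro tendsto_intros)
  have "eventually (\<lambda>s::real. of_real s * t \<in> \<Omega>) (at_left 1)"
    using topological_tendstoD[OF path \<Omega>(1)] \<Omega>(3) by simp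
  moreover have "eventually (\<lambda>s::real. 0 < s \<and> s < 1) (at_left 1)"
    using eventually_at_left_real[of 0 "1::real"] by (auto elim: eventually_mono)
  ultimately have "eventually (\<lambda>s::real. g (of_real s * t) = f (of_real s * t)) (at_left 1)"
  proof eventually_elim
    case (elim s)
    then have "of_real s * t \<in> \<Omega> \<inter> ?D" using False by (simp add: norm_mult)
    then show ?case using eq by simp
  qed
  with lim_g have lim_f: "((\<lambda>s::real. f (of_real s * t)) \<longlongrightarrow> S) (at_left 1)"
    by (simp cong: tendsto_cong)
  have "isCont f t"
    using hol \<Omega> holomorphic_on_imp_continuous_on continuous_on_eq_continuous_at by blast
  then have "((\<lambda>s::real. f (of_real s * t)) \<longlongrightarrow> f t) (at_left 1)"
    using isCont_tendsto_compose path by fastforce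
  with lim_f show ?thesis
    using tendsto_unique trivial_limit_at_left_real by blast
qed

text \<open>The substitution \<open>w = 1 / (1 - t)\<close> turns the exterior of the disc around \<open>1\<close> into a disc around \<open>0\<close> (the plane if \<open>\<rho> \<le> 0\<close>), and
\<open>\<bar>t\<bar> < s\<close> into \<open>\<bar>w - 1\<bar> < s \<bar>w\<bar>\<close>, which for \<open>s < 1\<close> is a disc of Apollonius. So the set is the continuous image of
an intersection of convex sets.\<close>

lemma connected_disc_minus_disc:
  assumes "s < 1"
  shows "connected ({t::complex. \<rho> < norm (1 - t)} \<inter> ball 0 s)"
proof (cases "0 < s")
  case False
  then show ?thesis by (simp add: ball_empty)
next
  case True
  define W where "W = {w::complex. \<rho> * norm w < 1} \<inter> {w. norm (w - 1) < s * norm w}"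
  have s2: "0 < 1 - s\<^sup>2" using assms True by (simp add: power_less_one_iff abs_square_less_1)
  \<comment> \<open>The centre of the disc of Apollonius; its radius is \<open>s c\<close>.\<close>
  define c where "c = 1 / (1 - s\<^sup>2)"
  have c: "c * (1 - s\<^sup>2) = 1" "0 < c" using s2 by (auto simp: c_def)
  have disc: "{w::complex. norm (w - 1) < s * norm w} = ball (of_real c) (s * c)"
  proof (intro set_eqI)
    fix w :: complex
    have e1: "(norm (w - 1))\<^sup>2 - (s * norm w)\<^sup>2 = (1 - s\<^sup>2) * (norm w)\<^sup>2 - 2 * Re w + 1"
      by (simp add: cmod_power2 power_mult_distrib) (simp add: power2_eq_square algebra_simps)
    have e2: "(norm (w - of_real c))\<^sup>2 - (s * c)\<^sup>2 = c * ((1 - s\<^sup>2) * (norm w)\<^sup>2 - 2 * Re w + 1)"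
    proof -
      have "(norm (w - of_real c))\<^sup>2 - (s * c)\<^sup>2 = (norm w)\<^sup>2 - 2 * c * Re w + c * (c * (1 - s\<^sup>2))"
        by (simp add: cmod_power2 power_mult_distrib) (simp add: power2_eq_square algebra_simps)
      also have "\<dots> = c * (1 - s\<^sup>2) * (norm w)\<^sup>2 - 2 * c * Re w + c" using c(1) by simp
      finally show ?thesis by (simp add: algebra_simps)
    qed
    have sq: "a < b \<longleftrightarrow> a\<^sup>2 < b\<^sup>2" if "0 \<le> a" "0 \<le> b" for a b :: real
      using that by (auto intro: power_strict_mono power2_less_imp_less)
    let ?X = "(1 - s\<^sup>2) * (norm w)\<^sup>2 - 2 * Re w + 1"
    have "norm (w - 1) < s * norm w \<longleftrightarrow> (norm (w - 1))\<^sup>2 < (s * norm w)\<^sup>2"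
      using True by (intro sq) auto
    also have "\<dots> \<longleftrightarrow> ?X < 0" using e1 by linarith
    also have "\<dots> \<longleftrightarrow> c * ?X < 0" using c(2) by (simp add: mult_less_0_iff)
    also have "\<dots> \<longleftrightarrow> (norm (w - of_real c))\<^sup>2 < (s * c)\<^sup>2" using e2 by linarith
    also have "\<dots> \<longleftrightarrow> norm (w - of_real c) < s * c"
      using True c(2) by (intro sq[symmetric]) auto
    finally show "w \<in> {w. norm (w - 1) < s * norm w} \<longleftrightarrow> w \<in> ball (of_real c) (s * c)"
      by (simp add: dist_norm norm_minus_commute)
  qed
  have "convex W"
  proof (cases "0 < \<rho>")
    case True
    then have "{w::complex. \<rho> * norm w < 1} = ball 0 (1 / \<rho>)" by (auto simp: field_simps)
    then show ?thesis unfolding W_def disc by (metis convex_Int convex_ball)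
  next
    case False
    then have "{w::complex. \<rho> * norm w < 1} = UNIV"
      by (auto intro: le_less_trans[OF mult_nonpos_nonneg])
    then show ?thesis unfolding W_def disc by simp
  qed
  have nz: "w \<noteq> 0" if "w \<in> W" for w using that by (auto simp: W_def)
  have "connected ((\<lambda>w. 1 - 1 / w) ` W)"
    using \<open>convex W\<close> nz
    by (intro connected_continuous_image continuous_intros convex_connected) auto
  also have "(\<lambda>w. 1 - 1 / w) ` W = {t. \<rho> < norm (1 - t)} \<inter> ball 0 s"
  proof (intro set_eqI iffI)
    fix t :: complex assume "t \<in> (\<lambda>w. 1 - 1 / w) ` W"
    then obtain w where w: "w \<in> W" "t = 1 - 1 / w" by blast
    have w0: "w \<noteq> 0" using nz[OF w(1)] .
    have n: "norm (1 - t) = 1 / norm w" by (simp add: w(2) norm_divide)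
    have "\<rho> < norm (1 - t)" unfolding n using w(1) w0 by (simp add: W_def pos_less_divide_eq)
    moreover have "t = (w - 1) / w" using w0 by (simp add: w(2) field_simps)
    then have nt: "norm t = norm (w - 1) / norm w" by (simp add: norm_divide)
    have "norm t < s" unfolding nt using w(1) w0 by (simp add: W_def pos_divide_less_eq)
    ultimately show "t \<in> {t. \<rho> < norm (1 - t)} \<inter> ball 0 s" by simp
  next
    fix t :: complex assume t: "t \<in> {t. \<rho> < norm (1 - t)} \<inter> ball 0 s"
    then have "t \<noteq> 1" using assms by force
    define w where "w = 1 / (1 - t)"
    have tw: "t = 1 - 1 / w" "w - 1 = t * w" "w \<noteq> 0" using \<open>t \<noteq> 1\<close> by (auto simp: w_def field_simps)
    have "\<rho> * norm w < 1" using t \<open>t \<noteq> 1\<close> by (simp add: w_def norm_divide field_simps)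
    moreover have "norm (w - 1) < s * norm w"
      unfolding tw(2) using t tw(3) by (simp add: norm_mult)
    ultimately show "t \<in> (\<lambda>w. 1 - 1 / w) ` W" using tw(1) by (auto simp: W_def)
  qed
  finally show ?thesis .
qed

section \<open>Expansion in t term by term\<close>

lemma bounded_linear_matrix_mult_both:
  fixes L R :: "complex^'d^'d"
  shows "bounded_linear (\<lambda>X. L ** X ** R)"
proof -
  have scaleR: "r *\<^sub>R X = mat (of_real r) ** X" for r and X :: "complex^'d^'d"
    by (simp add: vec_eq_iff) (simp add: scaleR_conv_of_real)
  have "linear (\<lambda>X. L ** X ** R)"
  proof (rule linearI)
    fix r and X :: "complex^'d^'d"
    have "L ** (mat (of_real r) ** X) ** R = mat (of_real r) ** (L ** X ** R)"
      unfolding mat_mult_left_commute by (rule matrix_mul_assoc[symmetric])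
    then show "L ** (r *\<^sub>R X) ** R = r *\<^sub>R (L ** X ** R)" by (simp only: scaleR)
  qed (simp add: matrix_add_ldistrib matrix_add_rdistrib)
  then show ?thesis by (simp add: linear_conv_bounded_linear)
qed

text \<open>The bound is itself a value of \<open>g\<close> on \<open>\<Omega>\<close>, so a strict inequality that holds at all points of \<open>\<Omega>\<close>, such as
\<open>\<bar>u(t)\<bar> < 1\<close>, yields a uniform bound below \<open>1\<close>.\<close>

lemma locally_bounded:
  fixes g :: "complex \<Rightarrow> real"
  assumes "continuous_on \<Omega> g" "cball z r \<subseteq> \<Omega>" "0 < r"
  obtains w where "w \<in> \<Omega>" "\<And>t. t \<in> cball z r \<Longrightarrow> g t \<le> g w"
proof -
  have "\<exists>w\<in>cball z r. \<forall>t\<in>cball z r. g t \<le> g w"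
    using assms by (intro continuous_attains_sup) (auto intro: continuous_on_subset)
  with that assms(2) show thesis by blast
qed

lemma opnorm_locally_bounded:
  fixes L :: "complex \<Rightarrow> complex^'d^'d"
  assumes "\<And>i j. (\<lambda>t. L t $ i $ j) holomorphic_on \<Omega>" "cball z r \<subseteq> \<Omega>" "0 < r"
  obtains c where "0 \<le> c" "\<And>t. t \<in> cball z r \<Longrightarrow> opnorm (L t) \<le> c"
proof -
  let ?g = "\<lambda>t. \<Sum>i\<in>UNIV. \<Sum>j\<in>UNIV. norm (L t $ i $ j)"
  have "continuous_on \<Omega> ?g"
    using assms(1) by (intro continuous_intros holomorphic_on_imp_continuous_on)
  then obtain w where "w \<in> \<Omega>" "\<And>t. t \<in> cball z r \<Longrightarrow> ?g t \<le> ?g w"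
    using locally_bounded[OF _ assms(2,3)] by blast
  then show thesis
    using opnorm_le_sum_components order_trans by (intro that[of "?g w"]) (auto intro!: sum_nonneg, blast)
qed

text \<open>The common frame of the three formulae. \<open>C\<close> are the coefficients of \<open>\<Gamma>\<^sub>1\<close>, \<open>G\<close> is its value at the arguments
\<open>u(t)\<close> and \<open>v(t)\<close>, and one of \<open>L\<close> and \<open>R\<close> is the power of \<open>1 - t\<close>, the other one the identity. \<open>D k\<close> are the coefficients of
the \<open>k\<close>-th summand \<open>H k\<close> of the right-hand side. The expansion hypothesis concerns only single terms; that the
expansions may be summed over all terms is Weierstrass' theorem. Holomorphic functions being scalar, the argument is
made for each matrix entry.\<close>

lemma horn_taylor_coefficients:
  fixes C :: "nat \<Rightarrow> nat \<Rightarrow> complex^'d^'d" and D :: "nat \<Rightarrow> nat \<Rightarrow> nat \<Rightarrow> complex^'d^'d"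
    and L R G :: "complex \<Rightarrow> complex^'d^'d"
  assumes \<Omega>: "open \<Omega>" "0 \<in> \<Omega>"
    and majorant: "\<And>q Y. 0 \<le> q \<Longrightarrow> q < 1 \<Longrightarrow> 0 \<le> Y \<Longrightarrow>
        (\<lambda>(m, n). q ^ m * Y ^ n / (fact m * fact n) * opnorm (C m n)) summable_on UNIV"
    and hol: "u holomorphic_on \<Omega>" "v holomorphic_on \<Omega>"
        "\<And>i j. (\<lambda>t. L t $ i $ j) holomorphic_on \<Omega>" "\<And>i j. (\<lambda>t. R t $ i $ j) holomorphic_on \<Omega>"
    and u: "\<And>t. t \<in> \<Omega> \<Longrightarrow> norm (u t) < 1"
    and G: "\<And>t. t \<in> \<Omega> \<Longrightarrow>
        ((\<lambda>(m, n). mat (u t ^ m * v t ^ n / (fact m * fact n)) ** C m n) has_sum G t) UNIV"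
    and expansion: "\<And>m n t. norm t < 1 \<Longrightarrow>
        (\<lambda>k. mat (t ^ k / fact k) ** (mat (x ^ m * y ^ n) ** D k m n)) sums
          (mat (u t ^ m * v t ^ n) ** (L t ** C m n ** R t))"
    and H: "\<And>k. ((\<lambda>(m, n). mat (x ^ m * y ^ n / (fact m * fact n)) ** D k m n) has_sum H k) UNIV"
  shows "(\<lambda>t. (L t ** G t ** R t) $ i $ j) holomorphic_on \<Omega>"
    and "(deriv ^^ k) (\<lambda>t. (L t ** G t ** R t) $ i $ j) 0 = H k $ i $ j"
proof -
  define T where "T = (\<lambda>(m, n) t. u t ^ m * v t ^ n / (fact m * fact n) * (L t ** C m n ** R t) $ i $ j)"
  let ?F = "\<lambda>t. \<Sum>\<^sub>\<infinity>p. T p t"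
  let ?f = "\<lambda>t. (L t ** G t ** R t) $ i $ j"
  have F: "?F t = ?f t" if "t \<in> \<Omega>" for t
  proof -
    have "bounded_linear (\<lambda>X. (L t ** X ** R t) $ i $ j)"
      using bounded_linear_compose[OF bounded_linear_vec_nth bounded_linear_compose[OF bounded_linear_vec_nth
          bounded_linear_matrix_mult_both]] .
    from has_sum_bounded_linear[OF this G[OF that]]
    have "((\<lambda>p. T p t) has_sum ?f t) UNIV"
      by (rule has_sum_cong[THEN iffD1, rotated])
        (auto simp: T_def mat_mult_left_commute simp flip: matrix_mul_assoc)
    then show ?thesis by (rule infsumI)
  qed
  have T_hol: "T p holomorphic_on \<Omega>" for p
    unfolding T_def matrix_matrix_mult_def
    by (cases p) (auto intro!: holomorphic_intros hol)
  have dom: "\<exists>U M. open U \<and> z \<in> U \<and> U \<subseteq> \<Omega> \<and> M summable_on UNIV \<and> (\<forall>p. \<forall>t\<in>U. norm (T p t) \<le> M p)"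
    if z: "z \<in> \<Omega>" for z
  proof -
    obtain r where r: "0 < r" "cball z r \<subseteq> \<Omega>" using \<Omega>(1) z open_contains_cball by blast
    have cont: "continuous_on \<Omega> (\<lambda>t. norm (u t))" "continuous_on \<Omega> (\<lambda>t. norm (v t))"
      using hol by (auto intro!: continuous_intros holomorphic_on_imp_continuous_on)
    obtain w1 where w1: "w1 \<in> \<Omega>" "\<And>t. t \<in> cball z r \<Longrightarrow> norm (u t) \<le> norm (u w1)"
      using locally_bounded[OF cont(1) r(2,1)] by blast
    obtain w2 where w2: "\<And>t. t \<in> cball z r \<Longrightarrow> norm (v t) \<le> norm (v w2)"
      using locally_bounded[OF cont(2) r(2,1)] by blast
    obtain cL where cL: "0 \<le> cL" "\<And>t. t \<in> cball z r \<Longrightarrow> opnorm (L t) \<le> cL"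
      using opnorm_locally_bounded[OF hol(3) r(2,1)] by blast
    obtain cR where cR: "0 \<le> cR" "\<And>t. t \<in> cball z r \<Longrightarrow> opnorm (R t) \<le> cR"
      using opnorm_locally_bounded[OF hol(4) r(2,1)] by blast
    define M where "M = (\<lambda>(m, n). norm (u w1) ^ m * norm (v w2) ^ n / (fact m * fact n) * opnorm (C m n))"
    have "M summable_on UNIV"
      unfolding M_def by (rule majorant) (use u[OF w1(1)] in auto)
    then have "(\<lambda>p. cL * cR * M p) summable_on UNIV" by (rule summable_on_cmult_right)
    moreover have "norm (T p t) \<le> cL * cR * M p" if "t \<in> ball z r" for p t
    proof -
      obtain m n where p: "p = (m, n)" by fastforce
      have t: "t \<in> cball z r" using that by auto
      have "norm ((L t ** C m n ** R t) $ i $ j) \<le> opnorm (L t) * opnorm (C m n) * opnorm (R t)"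
        by (rule order_trans[OF norm_component_le_opnorm])
          (meson opnorm_mult mult_right_mono opnorm_nonneg order_trans)
      also have "\<dots> \<le> cL * opnorm (C m n) * cR"
        using cL cR t by (intro mult_mono) (auto intro!: mult_nonneg_nonneg opnorm_nonneg)
      finally have "norm ((L t ** C m n ** R t) $ i $ j) \<le> cL * opnorm (C m n) * cR" .
      moreover have "norm (u t) ^ m * norm (v t) ^ n / (fact m * fact n)
          \<le> norm (u w1) ^ m * norm (v w2) ^ n / (fact m * fact n)"
        using w1(2)[OF t] w2[OF t] by (intro divide_right_mono mult_mono power_mono) auto
      ultimately have "norm (u t) ^ m * norm (v t) ^ n / (fact m * fact n) * norm ((L t ** C m n ** R t) $ i $ j)
          \<le> norm (u w1) ^ m * norm (v w2) ^ n / (fact m * fact n) * (cL * opnorm (C m n) * cR)"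
        by (intro mult_mono) auto
      then show ?thesis
        by (simp add: p T_def M_def norm_mult norm_divide norm_power mult_ac)
    qed
    ultimately show ?thesis
      using r by (intro exI[of _ "ball z r"] exI[of _ "\<lambda>p. cL * cR * M p"]) auto
  qed
  have "?F holomorphic_on \<Omega>"
    by (rule infsum_holomorphic(1)[OF \<Omega>(1) T_hol dom])
  then show "?f holomorphic_on \<Omega>"
    using F by (rule holomorphic_transform)
  have sum_deriv: "((\<lambda>p. (deriv ^^ k) (T p) 0) has_sum (deriv ^^ k) ?F 0) UNIV"
    by (rule infsum_holomorphic(2)[OF \<Omega>(1) T_hol dom \<Omega>(2)])
  have deriv_T: "(\<lambda>p. (deriv ^^ k) (T p) 0) =
      (\<lambda>p. (case p of (m, n) \<Rightarrow> mat (x ^ m * y ^ n / (fact m * fact n)) ** D k m n) $ i $ j)"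
  proof
    fix p :: "nat \<times> nat"
    obtain m n where p: "p = (m, n)" by fastforce
    define c where "c = (\<lambda>k. x ^ m * y ^ n / (fact m * fact n) * D k m n $ i $ j / fact k)"
    have "(\<lambda>k. c k * t ^ k) sums T p t" if "norm t < 1" for t
      using sums_mult[OF sums_vec_nth[OF sums_vec_nth[OF expansion[OF that]]], of "1 / (fact m * fact n)" m n i j]
      by (simp add: c_def p T_def mult_ac)
    then have "(deriv ^^ k) (T p) 0 = fact k * c k"
      by (rule higher_deriv_power_series[of 1, rotated]) auto
    then show "(deriv ^^ k) (T p) 0 =
        (case p of (m, n) \<Rightarrow> mat (x ^ m * y ^ n / (fact m * fact n)) ** D k m n) $ i $ j"
      by (simp add: p c_def)
  qed
  have "((\<lambda>p. (case p of (m, n) \<Rightarrow> mat (x ^ m * y ^ n / (fact m * fact n)) ** D k m n) $ i $ j)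
      has_sum H k $ i $ j) UNIV"
    by (intro has_sum_vec_nth H)
  from has_sum_unique[OF sum_deriv[unfolded deriv_T] this]
  have "(deriv ^^ k) ?F 0 = H k $ i $ j" .
  moreover have "(deriv ^^ k) ?f 0 = (deriv ^^ k) ?F 0"
    by (rule higher_deriv_cong_ev)
      (use F eventually_nhds_in_open[OF \<Omega>] in \<open>auto elim!: eventually_mono\<close>)
  ultimately show "(deriv ^^ k) ?f 0 = H k $ i $ j" by simp
qed

text \<open>Two ways to pass from the Taylor coefficients to the values: on a disc around \<open>0\<close> contained in \<open>\<Omega>\<close> the Taylor series
converges by itself, elsewhere in \<open>\<Omega>\<close> its convergence at \<open>t\<close> is assumed.\<close>

lemma horn_summation:
  fixes C :: "nat \<Rightarrow> nat \<Rightarrow> complex^'d^'d" and D :: "nat \<Rightarrow> nat \<Rightarrow> nat \<Rightarrow> complex^'d^'d"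
    and L R G :: "complex \<Rightarrow> complex^'d^'d"
  assumes \<Omega>: "open \<Omega>" "0 \<in> \<Omega>"
    and majorant: "\<And>q Y. 0 \<le> q \<Longrightarrow> q < 1 \<Longrightarrow> 0 \<le> Y \<Longrightarrow>
        (\<lambda>(m, n). q ^ m * Y ^ n / (fact m * fact n) * opnorm (C m n)) summable_on UNIV"
    and hol: "u holomorphic_on \<Omega>" "v holomorphic_on \<Omega>"
        "\<And>i j. (\<lambda>t. L t $ i $ j) holomorphic_on \<Omega>" "\<And>i j. (\<lambda>t. R t $ i $ j) holomorphic_on \<Omega>"
    and u: "\<And>t. t \<in> \<Omega> \<Longrightarrow> norm (u t) < 1"
    and G: "\<And>t. t \<in> \<Omega> \<Longrightarrow>
        ((\<lambda>(m, n). mat (u t ^ m * v t ^ n / (fact m * fact n)) ** C m n) has_sum G t) UNIV"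
    and expansion: "\<And>m n t. norm t < 1 \<Longrightarrow>
        (\<lambda>k. mat (t ^ k / fact k) ** (mat (x ^ m * y ^ n) ** D k m n)) sums
          (mat (u t ^ m * v t ^ n) ** (L t ** C m n ** R t))"
    and H: "\<And>k. ((\<lambda>(m, n). mat (x ^ m * y ^ n / (fact m * fact n)) ** D k m n) has_sum H k) UNIV"
  shows "ball 0 r \<subseteq> \<Omega> \<Longrightarrow> norm t < r \<Longrightarrow> summable (\<lambda>k. mat (t ^ k / fact k) ** H k)"
    and "t \<in> \<Omega> \<Longrightarrow> connected (\<Omega> \<inter> ball 0 (norm t)) \<Longrightarrow> summable (\<lambda>k. mat (t ^ k / fact k) ** H k) \<Longrightarrow>
      L t ** G t ** R t = (\<Sum>k. mat (t ^ k / fact k) ** H k)"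
proof -
  let ?f = "\<lambda>i j t. (L t ** G t ** R t) $ i $ j"
  let ?S = "\<lambda>k. mat (t ^ k / fact k) ** H k"
  note taylor = horn_taylor_coefficients[OF assms]
  have S: "?S k $ i $ j = (deriv ^^ k) (?f i j) 0 / fact k * t ^ k" for i j k
    by (simp add: taylor(2))
  {
    assume r: "ball 0 r \<subseteq> \<Omega>" "norm t < r"
    have "(\<lambda>k. ?S k $ i $ j) sums ?f i j t" for i j
      using holomorphic_power_series[OF holomorphic_on_subset[OF taylor(1) r(1)], of t i j] r(2)
      unfolding S by simp
    then have "?S sums (L t ** G t ** R t)" by (intro sums_vecI)
    then show "summable ?S" by (rule sums_summable)
  }
  assume t: "t \<in> \<Omega>" "connected (\<Omega> \<inter> ball 0 (norm t))" and "summable ?S"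
  then have "?S sums suminf ?S" by (intro summable_sums)
  then have "(\<lambda>k. ?S k $ i $ j) sums (suminf ?S $ i $ j)" for i j
    by (intro sums_vec_nth)
  then have "?f i j t = suminf ?S $ i $ j" for i j
    unfolding S by (intro taylor_series_eq[OF taylor(1) \<Omega> t])
  then show "L t ** G t ** R t = suminf ?S" by (simp add: vec_eq_iff)
qed

section \<open>The three summation formulae\<close>

text \<open>Every term of the three left-hand sides has this form: \<open>(1 - t)\<^bsup>-e\<^esup>\<close> comes from the scalar arguments of
\<open>\<Gamma>\<^sub>1\<close> and shifts the exponent \<open>M\<close> to \<open>M + eI\<close>.\<close>

lemma mpowr_expansion:
  fixes M P Q :: "complex^'d^'d"
  assumes "norm t < 1"
  shows "(\<lambda>k. mat (t ^ k / fact k) ** (mat c ** (P ** mpoch_nat (M + mat (of_int e)) k ** Q))) sums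
           (mat (c * (1 - t) powi (- e)) ** (P ** one_minus_mpowr t M ** Q))"
proof -
  let ?E = "\<lambda>X. mat c ** (P ** X ** Q)"
  have lin: "?E (mat b ** X) = mat b ** ?E X" for b X
    by (simp add: vec_eq_iff) (metis mat_mult_component mat_mult_left_commute matrix_mul_assoc mult.left_commute)
  have "bounded_linear ?E"
    using bounded_linear_compose[OF bounded_linear_matrix_mult_both[of "mat c" "mat 1"] bounded_linear_matrix_mult_both[of P Q]]
    by simp
  from bounded_linear.sums[OF this mpowr_sums[OF assms, of "M + mat (of_int e)"]]
  have "(\<lambda>k. mat (t ^ k / fact k) ** ?E (mpoch_nat (M + mat (of_int e)) k)) sums
      ?E (one_minus_mpowr t (M + mat (of_int e)))"
    by (simp only: lin)
  also have "?E (one_minus_mpowr t (M + mat (of_int e)))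
      = mat (c * (1 - t) powi (- e)) ** (P ** one_minus_mpowr t M ** Q)"
    unfolding mpowr_add_int[OF assms] lin
    by (simp add: matrix_mul_assoc mat_mult_mat mult.commute)
  finally show ?thesis .
qed

lemma Horn_Gamma1_mult_has_sum:
  fixes A B B' P Q :: "complex^'d^'d"
  assumes "mpoch_defined B" "mpoch_defined B'" "norm x < 1"
  shows "((\<lambda>(m, n). mat (x ^ m * y ^ n / (fact m * fact n)) ** (P ** horn_coeff A B B' m n ** Q))
           has_sum (P ** Horn_Gamma1 A B B' x y ** Q)) UNIV"
proof -
  have "P ** (mat w ** X) ** Q = mat w ** (P ** X ** Q)" for w and X :: "complex^'d^'d"
    unfolding mat_mult_left_commute by (rule matrix_mul_assoc[symmetric])
  then show ?thesis
    using has_sum_bounded_linear[OF bounded_linear_matrix_mult_both[of P Q] Horn_Gamma1_has_sum[OF assms, of y A]]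
    by (simp add: case_prod_unfold)
qed

lemma open_crescent: "open ({t::complex. \<rho> < norm (1 - t)} \<inter> ball 0 1)"
  by (intro open_Int open_Collect_less continuous_intros) auto

lemma ball_subset_crescent:
  assumes "r \<le> 1 - \<rho>" "0 \<le> \<rho>"
  shows "ball 0 r \<subseteq> {t::complex. \<rho> < norm (1 - t)} \<inter> ball 0 1"
proof
  fix t :: complex assume "t \<in> ball 0 r"
  then show "t \<in> {t. \<rho> < norm (1 - t)} \<inter> ball 0 1"
    using norm_triangle_ineq2[of 1 t] assms by simp
qed

text \<open>In \<open>mpowr_expansion\<close>, \<open>M = A\<close> and \<open>e = m\<close>: the coefficient identity is \<open>(A + m)\<^sub>k (A)\<^sub>m = (A)\<^sub>k (A + k)\<^sub>m\<close>.\<close>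

lemma Gamma1_summation_A:
  fixes A B B' :: "complex^'d^'d" and x y t :: complex
  defines "S \<equiv> \<lambda>k. mat (t ^ k / fact k) ** (mpoch_nat A k ** Horn_Gamma1 (A + mat (of_nat k)) B B' x y)"
  assumes def: "mpoch_defined B" "mpoch_defined B'" and t: "norm t < 1" and x: "norm x < 1"
    and xt: "norm x < norm (1 - t)"
  shows "norm x + norm t < 1 \<Longrightarrow> summable S"
    and "summable S \<Longrightarrow> one_minus_mpowr t A ** Horn_Gamma1 A B B' (x / (1 - t)) y = suminf S"
proof -
  let ?\<Omega> = "{t::complex. norm x < norm (1 - t)} \<inter> ball 0 1"
  let ?D = "\<lambda>k m n. mpoch_nat A k ** horn_coeff (A + mat (of_nat k)) B B' m n ** mat 1"
  note summation = horn_summation[where \<Omega> = ?\<Omega> and C = "horn_coeff A B B'" and x = x and y = y and t = t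
      and L = "\<lambda>t. one_minus_mpowr t A" and R = "\<lambda>t. mat 1" and u = "\<lambda>t. x / (1 - t)" and v = "\<lambda>t. y"
      and G = "\<lambda>t. Horn_Gamma1 A B B' (x / (1 - t)) y" and D = ?D
      and H = "\<lambda>k. mpoch_nat A k ** Horn_Gamma1 (A + mat (of_nat k)) B B' x y ** mat 1"]
  have nz: "1 - t \<noteq> 0" if "t \<in> ball 0 1" for t :: complex using that by auto
  have small: "norm (x / (1 - t)) < 1" if "t \<in> ?\<Omega>" for t
    using that nz[of t] by (simp add: norm_divide)
  have expansion: "(\<lambda>k. mat (t ^ k / fact k) ** (mat (x ^ m * y ^ n) ** ?D k m n)) sums
      (mat ((x / (1 - t)) ^ m * y ^ n) ** (one_minus_mpowr t A ** horn_coeff A B B' m n ** mat 1))"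
    if "norm t < 1" for m n t
  proof -
    let ?Q = "mpoch B (int n - int m) ** mpoch B' (int m - int n)"
    have D: "?D k m n = mat 1 ** mpoch_nat (A + mat (of_int (int m))) k ** (mpoch_nat A m ** ?Q)" for k
    proof -
      have "mpoch_nat (A + mat (of_nat m)) k ** mpoch_nat A m = mpoch_nat A m ** mpoch_nat (A + mat (of_nat m)) k"
        by (intro commutes_mpoch_nat commutes_mpoch_nat[symmetric] commutes_add_mat[symmetric]) simp
      also have "\<dots> = mpoch_nat A k ** mpoch_nat (A + mat (of_nat k)) m"
        by (simp add: mpoch_nat_add add.commute)
      finally show ?thesis by (simp add: horn_coeff_def matrix_mul_assoc)
    qed
    have w: "x ^ m * y ^ n * (1 - t) powi (- int m) = (x / (1 - t)) ^ m * y ^ n"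
      by (simp add: power_int_minus power_divide field_simps)
    show ?thesis
      using mpowr_expansion[OF that, of "x ^ m * y ^ n" "mat 1" A "int m" "mpoch_nat A m ** ?Q"]
      unfolding w D[symmetric] by (simp add: horn_coeff_def matrix_mul_assoc)
  qed
  have ass: "open ?\<Omega>" "0 \<in> ?\<Omega>" "t \<in> ?\<Omega>"
    using open_crescent x xt t by auto
  have hol: "(\<lambda>t. x / (1 - t)) holomorphic_on ?\<Omega>" "(\<lambda>t. y) holomorphic_on ?\<Omega>"
    "\<And>i j. (\<lambda>t. one_minus_mpowr t A $ i $ j) holomorphic_on ?\<Omega>"
    "\<And>i j. (\<lambda>t. (mat 1 :: complex^'d^'d) $ i $ j) holomorphic_on ?\<Omega>"
    using nz by (auto intro!: holomorphic_intros holomorphic_on_subset[OF mpowr_component_holomorphic])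
  have S: "(\<lambda>k. mat (t ^ k / fact k) ** (mpoch_nat A k ** Horn_Gamma1 (A + mat (of_nat k)) B B' x y ** mat 1)) = S"
    by (simp add: S_def)
  note concl = summation[unfolded S, OF ass(1,2) horn_majorant_summable[OF def] hol small
      Horn_Gamma1_has_sum[OF def small] expansion Horn_Gamma1_mult_has_sum[OF def x]]
  show "summable S" if "norm x + norm t < 1"
  proof -
    have r: "ball 0 (1 - norm x) \<subseteq> ?\<Omega>" by (rule ball_subset_crescent) simp_all
    have "norm t < 1 - norm x" using that by simp
    with r show ?thesis by (rule concl(1)[rotated -2]) assumption+
  qed
  show "one_minus_mpowr t A ** Horn_Gamma1 A B B' (x / (1 - t)) y = suminf S" if "summable S"
  proof -
    have "?\<Omega> \<inter> ball 0 (norm t) = {s. norm x < norm (1 - s)} \<inter> ball 0 (norm t)"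
      using t by auto
    then have "connected (?\<Omega> \<inter> ball 0 (norm t))"
      using connected_disc_minus_disc[OF t] by simp
    with ass(3) have "one_minus_mpowr t A ** Horn_Gamma1 A B B' (x / (1 - t)) y ** mat 1 = suminf S"
      using that by (rule concl(2)[rotated -3]) assumption+
    then show ?thesis by simp
  qed
qed


text \<open>In \<open>mpowr_expansion\<close>, \<open>M = B\<close> and \<open>e = n - m\<close>. The factor \<open>(B + e)\<^sub>k\<close> stands to the right of \<open>(B')\<^sub>-\<^sub>e\<close> and has to meet \<open>(B)\<^sub>e\<close> on its left,
after which \<open>(B)\<^sub>k\<close> moves back; this is where commutativity of \<open>B\<close> and \<open>B'\<close> enters.\<close>

lemma Gamma1_summation_B:
  fixes A B B' :: "complex^'d^'d" and x y t :: complex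
  defines "S \<equiv> \<lambda>k. mat (t ^ k / fact k) ** (Horn_Gamma1 A (B + mat (of_nat k)) B' x y ** mpoch_nat B k)"
  assumes def: "\<And>n::nat. mpoch_defined (B + mat (of_nat n))" "mpoch_defined B'" and comm: "B ** B' = B' ** B"
    and t: "norm t < 1" and x: "norm x < 1" and xt: "norm x * norm (1 - t) < 1"
  shows "norm x * (1 + norm t) < 1 \<Longrightarrow> summable S"
    and "summable S \<Longrightarrow> Horn_Gamma1 A B B' (x * (1 - t)) (y / (1 - t)) ** one_minus_mpowr t B = suminf S"
proof -
  let ?\<Omega> = "{t::complex. norm x * norm (1 - t) < 1} \<inter> ball 0 1"
  let ?D = "\<lambda>k m n. mat 1 ** horn_coeff A (B + mat (of_nat k)) B' m n ** mpoch_nat B k"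
  have defB: "mpoch_defined B" using def(1)[of 0] by simp
  note summation = horn_summation[where \<Omega> = ?\<Omega> and C = "horn_coeff A B B'" and x = x and y = y and t = t
      and L = "\<lambda>t. mat 1" and R = "\<lambda>t. one_minus_mpowr t B" and u = "\<lambda>t. x * (1 - t)" and v = "\<lambda>t. y / (1 - t)"
      and G = "\<lambda>t. Horn_Gamma1 A B B' (x * (1 - t)) (y / (1 - t))" and D = ?D
      and H = "\<lambda>k. mat 1 ** Horn_Gamma1 A (B + mat (of_nat k)) B' x y ** mpoch_nat B k"]
  have nz: "1 - t \<noteq> 0" if "t \<in> ball 0 1" for t :: complex using that by auto
  have small: "norm (x * (1 - t)) < 1" if "t \<in> ?\<Omega>" for t
    using that by (simp add: norm_mult)
  have expansion: "(\<lambda>k. mat (t ^ k / fact k) ** (mat (x ^ m * y ^ n) ** ?D k m n)) sums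
      (mat ((x * (1 - t)) ^ m * (y / (1 - t)) ^ n) ** (mat 1 ** horn_coeff A B B' m n ** one_minus_mpowr t B))"
    if t: "norm t < 1" for m n t
  proof -
    let ?N = "int n - int m"
    let ?B' = "mpoch B' (int m - int n)"
    have D: "?D k m n = horn_coeff A B B' m n ** mpoch_nat (B + mat (of_int ?N)) k ** mat 1" for k
    proof -
      have "?B' ** (B + mat (of_int ?N)) = (B + mat (of_int ?N)) ** ?B'"
        by (intro commutes_add_mat commutes_mpoch[symmetric] comm def(2))
      then have c1: "?B' ** mpoch_nat (B + mat (of_int ?N)) k = mpoch_nat (B + mat (of_int ?N)) k ** ?B'"
        by (rule commutes_mpoch_nat)
      have c2: "?B' ** mpoch_nat B k = mpoch_nat B k ** ?B'"
        by (intro commutes_mpoch_nat commutes_mpoch[symmetric] comm def(2))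
      have "mpoch B ?N ** mpoch_nat (B + mat (of_int ?N)) k = mpoch_nat B k ** mpoch (B + mat (of_nat k)) ?N"
        using mpoch_add_nat[OF defB, of ?N k] mpoch_nat_mult_mpoch[OF def(1), of k ?N] by (simp add: add.commute)
      also have "\<dots> = mpoch (B + mat (of_nat k)) ?N ** mpoch_nat B k"
        by (intro commutes_mpoch commutes_add_mat commutes_mpoch_nat[symmetric] def(1)) simp
      finally have "mpoch B ?N ** (mpoch_nat (B + mat (of_int ?N)) k ** ?B')
          = mpoch (B + mat (of_nat k)) ?N ** (mpoch_nat B k ** ?B')"
        by (simp only: matrix_mul_assoc)
      then have "mpoch B ?N ** (?B' ** mpoch_nat (B + mat (of_int ?N)) k)
          = mpoch (B + mat (of_nat k)) ?N ** (?B' ** mpoch_nat B k)"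
        by (simp only: c1 c2)
      then have "mpoch_nat A m ** (mpoch B ?N ** (?B' ** mpoch_nat (B + mat (of_int ?N)) k))
          = mpoch_nat A m ** (mpoch (B + mat (of_nat k)) ?N ** (?B' ** mpoch_nat B k))"
        by (rule arg_cong)
      then show ?thesis unfolding horn_coeff_def by (simp only: matrix_mul_assoc matrix_mul_lid matrix_mul_rid)
    qed
    have t1: "1 - t \<noteq> 0" using nz[of t] t by simp
    have "(1 - t) powi (- ?N) = (1 - t) ^ m / (1 - t) ^ n"
      using t1 power_int_diff[of "1 - t" "int m" "int n"] by simp
    then have w: "x ^ m * y ^ n * (1 - t) powi (- ?N) = (x * (1 - t)) ^ m * (y / (1 - t)) ^ n"
      by (simp only:) (simp add: power_divide power_mult_distrib)
    show ?thesis
      using mpowr_expansion[OF t, of "x ^ m * y ^ n" "horn_coeff A B B' m n" B ?N "mat 1"]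
      unfolding w D[symmetric] by simp
  qed
  have ass: "open ?\<Omega>" "0 \<in> ?\<Omega>" "t \<in> ?\<Omega>"
    using x xt t by (auto intro!: open_Int open_Collect_less continuous_intros)
  have hol: "(\<lambda>t. x * (1 - t)) holomorphic_on ?\<Omega>" "(\<lambda>t. y / (1 - t)) holomorphic_on ?\<Omega>"
    "\<And>i j. (\<lambda>t. (mat 1 :: complex^'d^'d) $ i $ j) holomorphic_on ?\<Omega>"
    "\<And>i j. (\<lambda>t. one_minus_mpowr t B $ i $ j) holomorphic_on ?\<Omega>"
    using nz by (auto intro!: holomorphic_intros holomorphic_on_subset[OF mpowr_component_holomorphic])
  have S: "(\<lambda>k. mat (t ^ k / fact k) ** (mat 1 ** Horn_Gamma1 A (B + mat (of_nat k)) B' x y ** mpoch_nat B k)) = S"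
    by (simp add: S_def)
  note concl = summation[unfolded S, OF ass(1,2) horn_majorant_summable[OF defB def(2)] hol small
      Horn_Gamma1_has_sum[OF defB def(2) small] expansion Horn_Gamma1_mult_has_sum[OF def x]]
  have disc: "{t::complex. norm x * norm (1 - t) < 1} = (if x = 0 then UNIV else ball 1 (1 / norm x))"
    by (auto simp: dist_norm field_simps)
  show "summable S" if "norm x * (1 + norm t) < 1"
  proof -
    \<comment> \<open>The largest radius with \<open>r \<le> 1\<close> and \<open>\<bar>x\<bar> (1 + r) \<le> 1\<close>.\<close>
    define r where "r = (if x = 0 then 1 else min 1 (1 / norm x - 1))"
    have "ball 0 r \<subseteq> ?\<Omega>"
    proof
      fix s :: complex assume s: "s \<in> ball 0 r"
      have "norm (1 - s) \<le> 1 + norm s" using norm_triangle_ineq4[of 1 s] by simp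
      then have "norm x * norm (1 - s) \<le> norm x * (1 + norm s)" by (rule mult_left_mono) simp
      also have "\<dots> < 1" using s by (auto simp: r_def field_simps split: if_splits)
      finally show "s \<in> ?\<Omega>" using s by (auto simp: r_def split: if_splits)
    qed
    moreover have "norm t < r" using that t by (auto simp: r_def field_simps)
    ultimately show ?thesis by (rule concl(1)[rotated -2]) assumption+
  qed
  show "Horn_Gamma1 A B B' (x * (1 - t)) (y / (1 - t)) ** one_minus_mpowr t B = suminf S" if "summable S"
  proof -
    have "connected (?\<Omega> \<inter> ball 0 (norm t))"
      unfolding disc by (auto intro!: convex_connected convex_Int)
    with ass(3) have "mat 1 ** Horn_Gamma1 A B B' (x * (1 - t)) (y / (1 - t)) ** one_minus_mpowr t B = suminf S"
      using that by (rule concl(2)[rotated -3]) assumption+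
    then show ?thesis by simp
  qed
qed

text \<open>In \<open>mpowr_expansion\<close>, \<open>M = B'\<close> and \<open>e = m - n\<close>. The power of \<open>1 - t\<close> stands next to \<open>(B')\<^sub>e\<close>, so the coefficients combine in place:
\<open>(B')\<^sub>e (B' + e)\<^sub>k = (B' + k)\<^sub>e (B')\<^sub>k\<close>.\<close>

lemma Gamma1_summation_B':
  fixes A B B' :: "complex^'d^'d" and x y t :: complex
  defines "S \<equiv> \<lambda>k. mat (t ^ k / fact k) ** (Horn_Gamma1 A B (B' + mat (of_nat k)) x y ** mpoch_nat B' k)"
  assumes def: "mpoch_defined B" "\<And>n::nat. mpoch_defined (B' + mat (of_nat n))"
    and t: "norm t < 1" and x: "norm x < 1" and xt: "norm x < norm (1 - t)"
  shows "norm x + norm t < 1 \<Longrightarrow> summable S"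
    and "summable S \<Longrightarrow> Horn_Gamma1 A B B' (x / (1 - t)) (y * (1 - t)) ** one_minus_mpowr t B' = suminf S"
proof -
  let ?\<Omega> = "{t::complex. norm x < norm (1 - t)} \<inter> ball 0 1"
  let ?D = "\<lambda>k m n. mat 1 ** horn_coeff A B (B' + mat (of_nat k)) m n ** mpoch_nat B' k"
  have defB': "mpoch_defined B'" using def(2)[of 0] by simp
  note summation = horn_summation[where \<Omega> = ?\<Omega> and C = "horn_coeff A B B'" and x = x and y = y and t = t
      and L = "\<lambda>t. mat 1" and R = "\<lambda>t. one_minus_mpowr t B'" and u = "\<lambda>t. x / (1 - t)" and v = "\<lambda>t. y * (1 - t)"
      and G = "\<lambda>t. Horn_Gamma1 A B B' (x / (1 - t)) (y * (1 - t))" and D = ?D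
      and H = "\<lambda>k. mat 1 ** Horn_Gamma1 A B (B' + mat (of_nat k)) x y ** mpoch_nat B' k"]
  have nz: "1 - t \<noteq> 0" if "t \<in> ball 0 1" for t :: complex using that by auto
  have small: "norm (x / (1 - t)) < 1" if "t \<in> ?\<Omega>" for t
    using that nz[of t] by (simp add: norm_divide)
  have expansion: "(\<lambda>k. mat (t ^ k / fact k) ** (mat (x ^ m * y ^ n) ** ?D k m n)) sums
      (mat ((x / (1 - t)) ^ m * (y * (1 - t)) ^ n) ** (mat 1 ** horn_coeff A B B' m n ** one_minus_mpowr t B'))"
    if t: "norm t < 1" for m n t
  proof -
    let ?N = "int m - int n"
    let ?AB = "mpoch_nat A m ** mpoch B (int n - int m)"
    have D: "?D k m n = horn_coeff A B B' m n ** mpoch_nat (B' + mat (of_int ?N)) k ** mat 1" for k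
    proof -
      have "mpoch B' ?N ** mpoch_nat (B' + mat (of_int ?N)) k = mpoch_nat B' k ** mpoch (B' + mat (of_nat k)) ?N"
        using mpoch_add_nat[OF defB', of ?N k] mpoch_nat_mult_mpoch[OF def(2), of k ?N] by (simp add: add.commute)
      also have "\<dots> = mpoch (B' + mat (of_nat k)) ?N ** mpoch_nat B' k"
        by (intro commutes_mpoch commutes_add_mat commutes_mpoch_nat[symmetric] def(2)) simp
      finally have "?AB ** (mpoch B' ?N ** mpoch_nat (B' + mat (of_int ?N)) k)
          = ?AB ** (mpoch (B' + mat (of_nat k)) ?N ** mpoch_nat B' k)"
        by (rule arg_cong)
      then show ?thesis unfolding horn_coeff_def by (simp only: matrix_mul_assoc matrix_mul_lid matrix_mul_rid)
    qed
    have t1: "1 - t \<noteq> 0" using nz[of t] t by simp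
    have "(1 - t) powi (- ?N) = (1 - t) ^ n / (1 - t) ^ m"
      using t1 power_int_diff[of "1 - t" "int n" "int m"] by simp
    then have w: "x ^ m * y ^ n * (1 - t) powi (- ?N) = (x / (1 - t)) ^ m * (y * (1 - t)) ^ n"
      by (simp only:) (simp add: power_divide power_mult_distrib)
    show ?thesis
      using mpowr_expansion[OF t, of "x ^ m * y ^ n" "horn_coeff A B B' m n" B' ?N "mat 1"]
      unfolding w D[symmetric] by simp
  qed
  have ass: "open ?\<Omega>" "0 \<in> ?\<Omega>" "t \<in> ?\<Omega>"
    using open_crescent x xt t by auto
  have hol: "(\<lambda>t. x / (1 - t)) holomorphic_on ?\<Omega>" "(\<lambda>t. y * (1 - t)) holomorphic_on ?\<Omega>"
    "\<And>i j. (\<lambda>t. (mat 1 :: complex^'d^'d) $ i $ j) holomorphic_on ?\<Omega>"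
    "\<And>i j. (\<lambda>t. one_minus_mpowr t B' $ i $ j) holomorphic_on ?\<Omega>"
    using nz by (auto intro!: holomorphic_intros holomorphic_on_subset[OF mpowr_component_holomorphic])
  have S: "(\<lambda>k. mat (t ^ k / fact k) ** (mat 1 ** Horn_Gamma1 A B (B' + mat (of_nat k)) x y ** mpoch_nat B' k)) = S"
    by (simp add: S_def)
  note concl = summation[unfolded S, OF ass(1,2) horn_majorant_summable[OF def(1) defB'] hol small
      Horn_Gamma1_has_sum[OF def(1) defB' small] expansion Horn_Gamma1_mult_has_sum[OF def x]]
  show "summable S" if "norm x + norm t < 1"
  proof -
    have r: "ball 0 (1 - norm x) \<subseteq> ?\<Omega>" by (rule ball_subset_crescent) simp_all
    have "norm t < 1 - norm x" using that by simp
    with r show ?thesis by (rule concl(1)[rotated -2]) assumption+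
  qed
  show "Horn_Gamma1 A B B' (x / (1 - t)) (y * (1 - t)) ** one_minus_mpowr t B' = suminf S" if "summable S"
  proof -
    have "?\<Omega> \<inter> ball 0 (norm t) = {s. norm x < norm (1 - s)} \<inter> ball 0 (norm t)"
      using t by auto
    then have "connected (?\<Omega> \<inter> ball 0 (norm t))"
      using connected_disc_minus_disc[OF t] by simp
    with ass(3) have "mat 1 ** Horn_Gamma1 A B B' (x / (1 - t)) (y * (1 - t)) ** one_minus_mpowr t B' = suminf S"
      using that by (rule concl(2)[rotated -3]) assumption+
    then show ?thesis by simp
  qed
qed

theorem theorem5p11:
  fixes A B B' :: "complex^'d^'d" and x y t :: complex
  assumes "norm t < 1" and "norm x < 1"
  defines "S1 \<equiv> \<lambda>n. mat (t ^ n / fact n) ** (mpoch A (int n) ** Horn_Gamma1 (A + mat (of_nat n)) B B' x y)"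
    and "S2 \<equiv> \<lambda>n. mat (t ^ n / fact n) ** (Horn_Gamma1 A (B + mat (of_nat n)) B' x y ** mpoch B (int n))"
    and "S3 \<equiv> \<lambda>n. mat (t ^ n / fact n) ** (Horn_Gamma1 A B (B' + mat (of_nat n)) x y ** mpoch B' (int n))"
  shows
    "(mpoch_defined B \<and> mpoch_defined B' \<and> norm (x / (1 - t)) < 1 \<longrightarrow>
        (norm x + norm t < 1 \<longrightarrow> summable S1) \<and>
        (summable S1 \<longrightarrow>
          one_minus_mpowr t A ** Horn_Gamma1 A B B' (x / (1 - t)) y = suminf S1)) \<and>
     ((\<forall>n::nat. mpoch_defined (B + mat (of_nat n))) \<and> mpoch_defined B' \<and>
        B ** B' = B' ** B \<and> norm (x * (1 - t)) < 1 \<longrightarrow>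
        (norm x * (1 + norm t) < 1 \<longrightarrow> summable S2) \<and>
        (summable S2 \<longrightarrow>
          Horn_Gamma1 A B B' (x * (1 - t)) (y / (1 - t)) ** one_minus_mpowr t B = suminf S2)) \<and>
     (mpoch_defined B \<and> (\<forall>n::nat. mpoch_defined (B' + mat (of_nat n))) \<and>
        norm (x / (1 - t)) < 1 \<longrightarrow>
        (norm x + norm t < 1 \<longrightarrow> summable S3) \<and>
        (summable S3 \<longrightarrow>
          Horn_Gamma1 A B B' (x / (1 - t)) (y * (1 - t)) ** one_minus_mpowr t B' = suminf S3))"
proof -
  have "1 - t \<noteq> 0" using assms(1) by auto
  then have small: "norm (x / (1 - t)) < 1 \<longleftrightarrow> norm x < norm (1 - t)"
    by (simp add: norm_divide)
  show ?thesis
    unfolding S1_def S2_def S3_def mpoch_of_nat small norm_mult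
    by (intro conjI impI; elim conjE)
      (blast intro: Gamma1_summation_A Gamma1_summation_B Gamma1_summation_B' assms(1,2))+
qed

end
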